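(* For all $f\in C$ and all integers $n\ge1$, the inequality $$E_{n-1}(f)\le c_r(\delta)\,\gamma_r^*\,\omega_r(f,\delta)$$ holds for $\delta=\frac{\pi}{n}$ with $r\in\{1,2,3,4\}$ and for $\delta=\frac{2\pi}{n}$ with $r\in\{1,\dots,6\}$, where $c_{2k-1}(\delta)=c_{2k}(\delta)$ and $$c_2\left(\tfrac{\pi}{n}\right)=1\tfrac14=\tfrac54,\qquad c_4\left(\tfrac{\pi}{n}\right)=2\tfrac{7}{10}=\tfrac{27}{10},$$ $$c_2\left(\tfrac{2\pi}{n}\right)=1\tfrac1{16}=\tfrac{17}{16},\qquad c_4\left(\tfrac{2\pi}{n}\right)=1\tfrac19=\tfrac{10}{9},\qquad c_6\left(\tfrac{2\pi}{n}\right)=1\tfrac12=\tfrac32.$$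
   Context: $C$ is the space of continuous $2\pi$-periodic functions $f$ on $\mathbb{R}$ with the uniform norm $\|f\|$. $T_{n-1}$ is the space of trigonometric polynomials of degree $\le n-1$, and $E_{n-1}(f)=\inf_{\tau\in T_{n-1}}\|f-\tau\|$. The $r$-th modulus of smoothness is $\omega_r(f,\delta)=\sup_{0<h\le\delta}\|\Delta_h^r(f,\cdot)\|$, where $\Delta_h^r(f,x)=\sum_{i=0}^r(-1)^i\binom{r}{i}f(x+ih)$. Also $\gamma_r^*=\binom{r}{\lfloor r/2\rfloor}^{-1}$. *)

theory Defs
  imports "HOL-Analysis.Analysis"
begin

text \<open>Suprema and infima below are those of the conditionally complete order of the reals, and are
  therefore meaningful only for nonempty, suitably bounded sets. For \<open>f \<in> C_per\<close> and \<open>\<delta> > 0\<close>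
  (the case in which the notions are used) all the sets involved have these properties.\<close>

definition C_per :: "(real \<Rightarrow> real) set" where
  "C_per = {f. continuous_on UNIV f \<and> (\<forall>x. f (x + 2 * pi) = f x)}"

definition sup_norm :: "(real \<Rightarrow> real) \<Rightarrow> real" where
  "sup_norm f = (SUP x. \<bar>f x\<bar>)"

definition trig_polys :: "nat \<Rightarrow> (real \<Rightarrow> real) set" where
  "trig_polys m =
     {\<tau>. \<exists>a b. \<forall>x. \<tau> x = (\<Sum>k\<le>m. a k * cos (real k * x) + b k * sin (real k * x))}"

definition best_approx :: "nat \<Rightarrow> (real \<Rightarrow> real) \<Rightarrow> real" where
  "best_approx m f = (INF \<tau>\<in>trig_polys m. sup_norm (\<lambda>x. f x - \<tau> x))"

definition diff_op :: "nat \<Rightarrow> real \<Rightarrow> (real \<Rightarrow> real) \<Rightarrow> real \<Rightarrow> real" where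
  "diff_op r h f x = (\<Sum>i=0..r. (-1) ^ i * real (r choose i) * f (x + real i * h))"

definition modulus_smoothness :: "nat \<Rightarrow> (real \<Rightarrow> real) \<Rightarrow> real \<Rightarrow> real" where
  "modulus_smoothness r f \<delta> = (SUP h\<in>{0<..\<delta>}. sup_norm (diff_op r h f))"

definition gamma_star :: "nat \<Rightarrow> real" where
  "gamma_star r = inverse (real (r choose (r div 2)))"

text \<open>The constants \<open>c\<^sub>r(\<pi>/n)\<close> and \<open>c\<^sub>r(2\<pi>/n)\<close> do not depend on \<open>n\<close>. They cannot be the values of one
  function of \<open>r\<close> and the number \<open>\<delta>\<close>, since \<open>\<pi>/n = 2\<pi>/(2n)\<close>, so they are two functions of \<open>r\<close>,
  relevant for \<open>1 \<le> r \<le> 4\<close> and \<open>1 \<le> r \<le> 6\<close> respectively. The case distinctions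
  incorporate the convention \<open>c\<^sub>2\<^sub>k\<^sub>-\<^sub>1 = c\<^sub>2\<^sub>k\<close>.\<close>

definition c_pi :: "nat \<Rightarrow> real" where
  "c_pi r = (if r \<le> 2 then 5/4 else 27/10)"

definition c_2pi :: "nat \<Rightarrow> real" where
  "c_2pi r = (if r \<le> 2 then 17/16 else if r \<le> 4 then 10/9 else 3/2)"

end

theory Submission
  imports Defs
begin

text \<open>
Write \<open>D t f x = f (x + t) - 2 f x + f (x - t)\<close>, and let \<open>S t f = D t P / t\<^sup>2\<close> with \<open>P'' = f\<close> be the Steklov
mean of \<open>f\<close>, so that \<open>(S t f)'' = D t f / t\<^sup>2\<close>. Let \<open>E\<close> be the best approximation of \<open>f\<close> and \<open>h\<close> the number \<open>\<delta>\<close> of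
the inequality. The proof compares \<open>f\<close> with a smoothed function \<open>A f\<close>, a combination of the Steklov
means \<open>S (i h) f\<close>, and approximates \<open>A f\<close> by trigonometric polynomials.

For order \<open>2k\<close> the weights of \<open>A\<close> are the normalised off-centre coefficients of the symmetric
difference of order \<open>2k\<close>. Then \<open>f - A f\<close> is, up to sign, an average of symmetric differences of \<open>f\<close> divided by their
central coefficient, which gives \<open>\<bar>f - A f\<bar> \<le> \<gamma> \<omega>\<close> with \<open>\<gamma>\<close> and \<open>\<omega>\<close> the numbers \<open>gamma_star (2k)\<close> and the modulus of
order \<open>2k\<close> (lemma \<open>steklov_error\<close>). The main term of the constant is therefore \<open>1\<close>.

It remains to approximate \<open>A f\<close>, where Favard's sharp inequality \<open>E(F) \<le> \<pi>\<^sup>2 / (8 n\<^sup>2) * max \<bar>F''\<bar>\<close> applies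
(theorem \<open>favard_second_order\<close>). With \<open>\<kappa> = \<pi>\<^sup>2 / (8 n\<^sup>2 h\<^sup>2)\<close>, which is \<open>1/8\<close> for \<open>h = \<pi>/n\<close> and \<open>1/32\<close> for \<open>h = 2\<pi>/n\<close>, the
bounds are as follows; \<open>\<tau>\<close> is a nearly best approximation of \<open>f\<close>.

\<^item> Order 2: \<open>A = S h\<close> and \<open>h\<^sup>2 (A f)'' = D h f\<close> is bounded by \<open>\<omega>\<close>, hence \<open>E \<le> (1 + 2\<kappa>) \<gamma> \<omega>\<close>.

\<^item> Order 4: \<open>h\<^sup>2 (A f)'' = 1/4 * D (2h) f - 1/3 * D h (D h f)\<close>. The last summand is a fourth difference of \<open>f\<close>; in the
other one \<open>f\<close> may be replaced by \<open>f - \<tau>\<close>. Hence \<open>E \<le> \<gamma> \<omega> + \<kappa> (2 \<gamma> \<omega> + E)\<close>, which is solved for \<open>E\<close>.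

\<^item> Order 6: replacing \<open>f\<close> by \<open>f - \<tau>\<close> everywhere, \<open>E \<le> \<gamma> \<omega> + \<kappa> * 299/45 * E\<close>.

The odd orders follow from \<open>\<omega>\<close> of order \<open>2k\<close> being at most twice that of order \<open>2k - 1\<close>.

The proof of Favard's inequality rests on a kernel. A periodic \<open>F\<close> is, up to a constant, the
convolution of \<open>F''\<close> with a multiple of \<open>\<theta>\<^sup>2\<close> on \<open>[-\<pi>, \<pi>]\<close>, and the convolution of \<open>F''\<close> with a cosine polynomial
\<open>\<sigma>\<close> of degree less than \<open>n\<close> is a trigonometric polynomial of the same degree. So one needs a \<open>\<sigma>\<close> for which
\<open>\<theta>\<^sup>2 - \<sigma> \<theta>\<close> has a small integral norm: the one that interpolates \<open>\<theta>\<^sup>2\<close> at the zeros of \<open>cos (n \<theta>)\<close>. In the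
variable \<open>u = 1 - cos \<theta>\<close> the function \<open>\<theta>\<^sup>2\<close> is a power series with nonnegative coefficients, and a divided
difference of such a series is again of this kind (lemma \<open>nonneg_power_series_divide_linear\<close>). Hence the
interpolation error has the sign of the product of the factors \<open>u - u i\<close>, that is, up to a constant factor the sign of
\<open>cos (n \<theta>)\<close>. As this sign is orthogonal to the cosine polynomials of degree less than \<open>n\<close>, the norm is computed
explicitly (lemma \<open>favard_kernel_L1_norm\<close>).
\<close>

section \<open>Power series with nonnegative coefficients\<close>

definition nonneg_power_series :: "real \<Rightarrow> (real \<Rightarrow> real) \<Rightarrow> bool" where
  "nonneg_power_series R g \<longleftrightarrow>
     (\<exists>c. (\<forall>k. c k \<ge> 0) \<and> (\<forall>u. 0 \<le> u \<longrightarrow> u < R \<longrightarrow> (\<lambda>k. c k * u ^ k) sums g u))"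

lemma nonneg_power_series_nonneg:
  assumes "nonneg_power_series R g" "0 \<le> u" "u < R"
  shows "g u \<ge> 0"
proof -
  from assms(1) obtain c where c: "\<forall>k. c k \<ge> 0" "\<forall>u. 0 \<le> u \<longrightarrow> u < R \<longrightarrow> (\<lambda>k. c k * u ^ k) sums g u"
    unfolding nonneg_power_series_def by (elim exE conjE)
  from c(2) assms(2,3) have s: "(\<lambda>k. c k * u ^ k) sums g u" by simp
  show ?thesis by (rule sums_le[OF _ sums_zero s]) (use c(1) assms(2) in simp)
qed

text \<open>This is the step that makes interpolation of an absolutely monotone function explicit: the
  divided difference \<open>q u = (g u - g a) / (u - a)\<close> is again such a function. Its coefficients
  \<open>d k = c (k+1) + c (k+2) * a + c (k+3) * a^2 + \<dots>\<close> are manifestly nonnegative and satisfy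
  \<open>d k = c (k+1) + a * d (k+1)\<close>, so that the partial sums of \<open>(u - a) * q u\<close> telescope. The only
  analytic point is \<open>d K * u ^ (K+1) \<longlonglongrightarrow> 0\<close>, which follows from \<open>d K \<le> g v / v ^ (K+1)\<close> for a
  \<open>v < R\<close> that exceeds \<open>u\<close> and is at least \<open>a\<close>.\<close>

lemma nonneg_power_series_divide_linear:
  assumes "nonneg_power_series R g" and a: "0 \<le> a" "a < R"
  obtains q where "nonneg_power_series R q"
    and "\<And>u. 0 \<le> u \<Longrightarrow> u < R \<Longrightarrow> g u = g a + (u - a) * q u"
proof -
  from assms(1) obtain c where c': "\<forall>k. c k \<ge> 0"
    and g': "\<forall>u. 0 \<le> u \<longrightarrow> u < R \<longrightarrow> (\<lambda>k. c k * u ^ k) sums g u"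
    unfolding nonneg_power_series_def by (elim exE conjE)
  from c' have c: "c k \<ge> 0" for k by simp
  from g' have g: "(\<lambda>k. c k * u ^ k) sums g u" if "0 \<le> u" "u < R" for u using that by simp
  have cs: "summable (\<lambda>k. c k * u ^ k)" if "0 \<le> u" "u < R" for u
    using g[OF that] by (rule sums_summable)
  have tail: "summable (\<lambda>j. c (j + k) * u ^ (j + k))" if "0 \<le> u" "u < R" for u k
    using cs[OF that] summable_iff_shift[of "\<lambda>k. c k * u ^ k" k] by simp
  define d where "d = (\<lambda>k. \<Sum>j. c (j + Suc k) * a ^ j)"
  have bd: "summable (\<lambda>j. c (j + Suc k) * a ^ j) \<and> d k * v ^ Suc k \<le> g v"
    if v: "0 < v" "a \<le> v" "v < R" for v k
  proof -
    have le: "c (j + Suc k) * a ^ j * v ^ Suc k \<le> c (j + Suc k) * v ^ (j + Suc k)" for j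
    proof -
      have "c (j + Suc k) * (a ^ j * v ^ Suc k) \<le> c (j + Suc k) * (v ^ j * v ^ Suc k)"
        using c a v by (intro mult_left_mono mult_right_mono power_mono) auto
      then show ?thesis by (simp only: power_add mult.assoc)
    qed
    have s1: "summable (\<lambda>j. c (j + Suc k) * a ^ j * v ^ Suc k)"
      by (rule summable_comparison_test'[OF tail[of v "Suc k"]])
         (use v c a le in \<open>auto simp: abs_mult\<close>)
    then have s2: "summable (\<lambda>j. c (j + Suc k) * a ^ j)"
      using v(1) summable_cmult_iff[of "v ^ Suc k" "\<lambda>j. c (j + Suc k) * a ^ j"]
      by (simp add: mult_ac)
    have "d k * v ^ Suc k = (\<Sum>j. c (j + Suc k) * a ^ j * v ^ Suc k)"
      unfolding d_def by (rule suminf_mult2[OF s2])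
    also have "\<dots> \<le> (\<Sum>j. c (j + Suc k) * v ^ (j + Suc k))"
      using v by (intro suminf_le le s1 tail) auto
    also have "\<dots> \<le> (\<Sum>j. c (j + Suc k) * v ^ (j + Suc k)) + (\<Sum>i<Suc k. c i * v ^ i)"
      using c v by (simp add: sum_nonneg)
    also have "\<dots> = (\<Sum>k. c k * v ^ k)"
      using suminf_split_initial_segment[OF cs, of v "Suc k"] v by simp
    also have "\<dots> = g v" using g[of v] v by (simp add: sums_iff)
    finally show ?thesis using s2 by blast
  qed
  have d0: "d k \<ge> 0" for k
    unfolding d_def using bd[of "(a + R) / 2" k] a c by (intro suminf_nonneg) auto
  have rec: "d k = c (Suc k) + a * d (Suc k)" for k
  proof -
    have s: "summable (\<lambda>j. c (j + Suc k) * a ^ j)" "summable (\<lambda>j. c (j + Suc (Suc k)) * a ^ j)"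
      using bd[of "(a + R) / 2" k, THEN conjunct1] bd[of "(a + R) / 2" "Suc k", THEN conjunct1] a by simp_all
    have "d k = (\<Sum>j. c (Suc j + Suc k) * a ^ Suc j) + c (Suc k)"
      unfolding d_def using suminf_split_head[OF s(1)] by simp
    also have "(\<Sum>j. c (Suc j + Suc k) * a ^ Suc j) = a * d (Suc k)"
      unfolding d_def by (subst suminf_mult[OF s(2), symmetric]) (simp add: mult_ac)
    finally show ?thesis by simp
  qed
  have rec0: "g a = c 0 + a * d 0"
  proof -
    have s: "summable (\<lambda>j. c (j + Suc 0) * a ^ j)" using bd[of "(a + R) / 2" 0] a by auto
    have "g a = (\<Sum>k. c k * a ^ k)" using g[of a] a by (simp add: sums_iff)
    also have "\<dots> = (\<Sum>k. c (Suc k) * a ^ Suc k) + c 0"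
      using suminf_split_head[OF cs[of a]] a by simp
    also have "(\<Sum>k. c (Suc k) * a ^ Suc k) = a * d 0"
      unfolding d_def by (subst suminf_mult[OF s, symmetric]) (simp add: mult_ac)
    finally show ?thesis by simp
  qed
  have part: "(u - a) * (\<Sum>k<Suc K. d k * u ^ k) = (\<Sum>k<Suc K. c k * u ^ k) + d K * u ^ Suc K - g a"
    for u K
  proof (induction K)
    case 0 then show ?case using rec0 by (simp add: algebra_simps)
  next
    case (Suc K)
    have "(u - a) * (\<Sum>k<Suc (Suc K). d k * u ^ k)
        = (u - a) * (\<Sum>k<Suc K. d k * u ^ k) + (u - a) * (d (Suc K) * u ^ Suc K)"
      by (simp only: sum.lessThan_Suc[of _ "Suc K"] distrib_left)
    also have "\<dots> = (\<Sum>k<Suc K. c k * u ^ k) + d K * u ^ Suc K - g a + (u - a) * (d (Suc K) * u ^ Suc K)"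
      unfolding Suc.IH by (rule refl)
    also have "\<dots> = (\<Sum>k<Suc K. c k * u ^ k) + (d K - a * d (Suc K)) * u ^ Suc K
        + d (Suc K) * u ^ Suc (Suc K) - g a"
      by (simp add: algebra_simps del: sum.lessThan_Suc)
    also have "d K - a * d (Suc K) = c (Suc K)" using rec[of K] by linarith
    finally show ?case by (simp only: sum.lessThan_Suc[of _ "Suc K"])
  qed
  have main: "summable (\<lambda>k. d k * u ^ k) \<and> g u = g a + (u - a) * (\<Sum>k. d k * u ^ k)"
    if u: "0 \<le> u" "u < R" for u
  proof -
    define v where "v = (max a u + R) / 2"
    have v: "0 < v" "a \<le> v" "v < R" "u < v" using u a by (auto simp: v_def)
    have dv: "d k \<le> g v / v ^ Suc k" for k
      using bd[OF v(1-3), of k] v(1) by (simp add: field_simps)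
    have le: "d k * u ^ k \<le> g v / v * (u / v) ^ k" for k
      using mult_right_mono[OF dv[of k], of "u ^ k"] u by (simp add: power_divide mult_ac)
    have q: "norm (u / v) < 1" using u v by simp
    have s: "summable (\<lambda>k. d k * u ^ k)"
      by (rule summable_comparison_test'[OF summable_mult[OF summable_geometric[OF q], of "g v / v"]])
         (use le d0 u in \<open>auto simp: abs_mult\<close>)
    have z: "(\<lambda>K. d K * u ^ Suc K) \<longlonglongrightarrow> 0"
      using tendsto_mult_left[OF summable_LIMSEQ_zero[OF s], of u] by (simp add: mult_ac)
    have gu: "(\<lambda>K. \<Sum>k<Suc K. c k * u ^ k) \<longlonglongrightarrow> g u"
      using g[OF u] unfolding sums_def by (rule LIMSEQ_Suc)
    have du: "(\<lambda>K. \<Sum>k<Suc K. d k * u ^ k) \<longlonglongrightarrow> (\<Sum>k. d k * u ^ k)"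
      using summable_LIMSEQ[OF s] by (rule LIMSEQ_Suc)
    have "(\<lambda>K. (\<Sum>k<Suc K. c k * u ^ k) + d K * u ^ Suc K - g a) \<longlonglongrightarrow> g u + 0 - g a"
      by (rule tendsto_diff[OF tendsto_add[OF gu z] tendsto_const])
    moreover have "(\<lambda>K. (u - a) * (\<Sum>k<Suc K. d k * u ^ k)) \<longlonglongrightarrow> (u - a) * (\<Sum>k. d k * u ^ k)"
      by (rule tendsto_mult_left[OF du])
    ultimately have "(u - a) * (\<Sum>k. d k * u ^ k) = g u + 0 - g a"
      unfolding part using LIMSEQ_unique by blast
    with s show ?thesis by simp
  qed
  have "(\<lambda>k. d k * u ^ k) sums (\<Sum>k. d k * u ^ k)" if "0 \<le> u" "u < R" for u
    using main[OF that] by (intro summable_sums) blast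
  then have 1: "nonneg_power_series R (\<lambda>u. \<Sum>k. d k * u ^ k)"
    unfolding nonneg_power_series_def using d0 by (intro exI[of _ d] conjI allI impI)
  show thesis
  proof (rule that[OF 1])
    show "g u = g a + (u - a) * (\<Sum>k. d k * u ^ k)" if "0 \<le> u" "u < R" for u
      by (rule main[OF that, THEN conjunct2])
  qed
qed

text \<open>The Maclaurin coefficients of the derivative of \<open>(arccos (1 - u))\<^sup>2\<close>.\<close>

primrec arccos_coeff :: "nat \<Rightarrow> real" where
  "arccos_coeff 0 = 2"
| "arccos_coeff (Suc k) = real (k + 1) / real (2 * k + 3) * arccos_coeff k"

lemma arccos_coeff_bounds: "0 \<le> arccos_coeff k \<and> arccos_coeff k \<le> 2 * (1 / 2) ^ k"
proof (induction k)
  case (Suc k)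
  have "real (k + 1) / real (2 * k + 3) * arccos_coeff k \<le> 1 / 2 * (2 * (1 / 2) ^ k)"
    using Suc by (intro mult_mono) (auto simp: field_simps)
  with Suc show ?case by simp
qed simp

text \<open>In the variable \<open>u = 1 - cos \<theta>\<close> the function \<open>\<theta>\<^sup>2\<close> has a power series with nonnegative
  coefficients, although \<open>arccos\<close> itself is singular at \<open>u = 0\<close>. If \<open>z\<close> denotes the sum of the series,
  the recursion of the coefficients is the differential equation
  \<open>(2u - u\<^sup>2) z'' + (1 - u) z' = 2\<close>, which says that the second derivative of
  \<open>\<theta> \<mapsto> z (1 - cos \<theta>)\<close> is \<open>2\<close>; the initial values at \<open>\<theta> = 0\<close> then identify it with \<open>\<theta>\<^sup>2\<close>.\<close>

lemma angle_square_series: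
  "nonneg_power_series 2 (\<lambda>u. (arccos (1 - u))\<^sup>2)"
proof -
  let ?e = arccos_coeff
  define c where "c = (\<lambda>k. if k = 0 then 0 else ?e (k - 1) / real k)"
  have c0: "c k \<ge> 0" for k using arccos_coeff_bounds by (simp add: c_def)
  have dc: "diffs c = ?e" by (auto simp: diffs_def c_def fun_eq_iff)
  have se: "summable (\<lambda>k. ?e k * u ^ k)" if "norm u < 2" for u :: real
  proof (rule summable_comparison_test'[OF summable_mult[OF summable_geometric, of "norm u / 2" 2]])
    show "norm (?e k * u ^ k) \<le> 2 * (norm u / 2) ^ k" for k
      using mult_right_mono[of "?e k" "2 * (1 / 2) ^ k" "norm u ^ k"] arccos_coeff_bounds[of k]
      by (simp add: abs_mult power_abs power_divide)
  qed (use that in auto)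
  have sc: "summable (\<lambda>k. c k * u ^ k)" if u: "norm u < 2" for u :: real
  proof -
    have "summable (\<lambda>k. norm u * norm (?e k * norm u ^ k))"
      using se[of "norm u"] u arccos_coeff_bounds by (intro summable_mult) (simp add: abs_mult)
    then have "summable (\<lambda>k. c (Suc k) * u ^ Suc k)"
    proof (rule summable_comparison_test'[where N = 0])
      fix k
      have "\<bar>?e k / real (Suc k)\<bar> \<le> \<bar>?e k\<bar>" using arccos_coeff_bounds[of k] by (simp add: divide_simps mult_le_cancel_left1)
      then have "\<bar>?e k / real (Suc k)\<bar> * \<bar>u\<bar> ^ Suc k \<le> \<bar>?e k\<bar> * \<bar>u\<bar> ^ Suc k"
        by (rule mult_right_mono) simp
      then show "norm (c (Suc k) * u ^ Suc k) \<le> norm u * norm (?e k * norm u ^ k)"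
        by (simp add: c_def abs_mult power_abs mult_ac)
    qed
    then show ?thesis using summable_Suc_iff by blast
  qed
  define z where "z = (\<lambda>u. \<Sum>k. c k * u ^ k)"
  define v where "v = (\<lambda>u. \<Sum>k. ?e k * u ^ k)"
  define w where "w = (\<lambda>u. \<Sum>k. diffs ?e k * u ^ k)"
  have dz: "(z has_real_derivative v u) (at u)" if "norm u < 2" for u
    using termdiffs_strong'[of 2 c u] that sc unfolding z_def v_def dc by simp
  have dv: "(v has_real_derivative w u) (at u)" if "norm u < 2" for u
    using termdiffs_strong'[of 2 ?e u] that se unfolding v_def w_def by simp
  \<comment> \<open>The recursion of the coefficients, summed: \<open>u * w u\<close> has the coefficients \<open>k * e k\<close>.\<close>
  have ode: "(2 * u - u\<^sup>2) * w u + (1 - u) * v u = 2" if u: "norm u < 2" for u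
  proof -
    have sw: "summable (\<lambda>k. diffs ?e k * u ^ k)"
      using termdiff_converges[of u 2 ?e] se u by simp
    have "(\<lambda>k. real (Suc k) * ?e (Suc k) * u ^ Suc k) sums (u * w u)"
      using sums_mult[OF summable_sums[OF sw], of u] by (simp add: diffs_def w_def mult_ac)
    then have A: "(\<lambda>k. real k * ?e k * u ^ k) sums (u * w u)"
      using sums_Suc_iff[of "\<lambda>k. real k * ?e k * u ^ k"] by simp
    have V: "(\<lambda>k. ?e k * u ^ k) sums v u" unfolding v_def by (rule summable_sums[OF se[OF u]])
    have "(\<lambda>k. (2 * real k + 1) * ?e k * u ^ k) sums (2 * (u * w u) + v u)"
      using sums_add[OF sums_mult[OF A, of 2] V] by (simp add: algebra_simps)
    then have "(\<lambda>k. (2 * real (Suc k) + 1) * ?e (Suc k) * u ^ Suc k) sums (2 * (u * w u) + v u - 2)"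
      using sums_Suc_iff[of "\<lambda>k. (2 * real k + 1) * ?e k * u ^ k" "2 * (u * w u) + v u - 2"] by simp
    moreover have "(2 * real (Suc k) + 1) * ?e (Suc k) * u ^ Suc k = u * (real k * ?e k * u ^ k + ?e k * u ^ k)" for k
    proof -
      have "(2 * real (Suc k) + 1) * ?e (Suc k) = (real k + 1) * ?e k"
        by (simp add: field_simps)
      then show ?thesis by (simp add: algebra_simps)
    qed
    ultimately have "(\<lambda>k. u * (real k * ?e k * u ^ k + ?e k * u ^ k)) sums (2 * (u * w u) + v u - 2)"
      by simp
    moreover have "(\<lambda>k. u * (real k * ?e k * u ^ k + ?e k * u ^ k)) sums (u * (u * w u + v u))"
      by (intro sums_mult sums_add A V)
    ultimately have "2 * (u * w u) + v u - 2 = u * (u * w u + v u)" by (rule sums_unique2)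
    then show ?thesis by (simp add: algebra_simps power2_eq_square)
  qed
  have nu: "norm (1 - cos \<theta>) < 2" if "0 \<le> \<theta>" "\<theta> < pi" for \<theta> :: real
    using cos_monotone_0_pi[of \<theta> pi] that by simp
  \<comment> \<open>The left-hand side is the derivative of \<open>z (1 - cos \<theta>)\<close>, here identified before \<open>z\<close> itself.\<close>
  have id1: "sin \<theta> * v (1 - cos \<theta>) = 2 * \<theta>" if t: "0 \<le> \<theta>" "\<theta> < pi" for \<theta>
  proof -
    have "\<exists>C. \<forall>s\<in>{0..<pi}. sin s * v (1 - cos s) - 2 * s = C"
    proof (rule has_field_derivative_zero_constant)
      fix s :: real assume s: "s \<in> {0..<pi}"
      have "((\<lambda>s. sin s * v (1 - cos s) - 2 * s) has_real_derivative
              cos s * v (1 - cos s) + sin s * (w (1 - cos s) * sin s) - 2) (at s)"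
        using s by (auto intro!: derivative_eq_intros DERIV_chain2[OF dv] nu)
      moreover have "cos s * v (1 - cos s) + sin s * (w (1 - cos s) * sin s) - 2 = 0"
      proof -
        have "2 * (1 - cos s) - (1 - cos s)\<^sup>2 = (sin s)\<^sup>2"
          by (simp add: sin_squared_eq power2_eq_square algebra_simps)
        then show ?thesis using ode[OF nu, of s] s by (simp add: power2_eq_square mult_ac)
      qed
      ultimately show "((\<lambda>s. sin s * v (1 - cos s) - 2 * s) has_real_derivative 0) (at s within {0..<pi})"
        by (auto intro: has_field_derivative_at_within)
    qed simp
    then obtain C where C: "\<And>s. s \<in> {0..<pi} \<Longrightarrow> sin s * v (1 - cos s) - 2 * s = C" by blast
    from C[of 0] C[of \<theta>] t show ?thesis by simp
  qed
  have id2: "z (1 - cos \<theta>) = \<theta>\<^sup>2" if t: "0 \<le> \<theta>" "\<theta> < pi" for \<theta>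
  proof -
    have "\<exists>C. \<forall>s\<in>{0..<pi}. z (1 - cos s) - s\<^sup>2 = C"
    proof (rule has_field_derivative_zero_constant)
      fix s :: real assume s: "s \<in> {0..<pi}"
      have "((\<lambda>s. z (1 - cos s) - s\<^sup>2) has_real_derivative v (1 - cos s) * sin s - 2 * s) (at s)"
        using s by (auto intro!: derivative_eq_intros DERIV_chain2[OF dz] nu)
      then show "((\<lambda>s. z (1 - cos s) - s\<^sup>2) has_real_derivative 0) (at s within {0..<pi})"
        using id1[of s] s by (auto intro: has_field_derivative_at_within simp: mult_ac)
    qed simp
    then obtain C where C: "\<And>s. s \<in> {0..<pi} \<Longrightarrow> z (1 - cos s) - s\<^sup>2 = C" by blast
    have "z 0 = 0" using powser_zero[of c] by (simp add: z_def c_def)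
    with C[of 0] C[of \<theta>] t show ?thesis by simp
  qed
  have "(\<lambda>k. c k * u ^ k) sums (arccos (1 - u))\<^sup>2" if "0 \<le> u" "u < 2" for u
  proof -
    have "arccos (1 - u) < arccos (-1)" using that by (intro arccos_less_arccos) auto
    then have "z u = (arccos (1 - u))\<^sup>2"
      using id2[of "arccos (1 - u)"] that by (simp add: arccos_lbound)
    then show ?thesis using summable_sums[OF sc[of u]] that by (simp add: z_def)
  qed
  with c0 show ?thesis unfolding nonneg_power_series_def by blast
qed

section \<open>Interpolation of the squared angle by cosine polynomials\<close>

definition cos_polys :: "nat \<Rightarrow> (real \<Rightarrow> real) set" where
  "cos_polys n = {\<sigma>. \<exists>b. \<forall>\<theta>. \<sigma> \<theta> = (\<Sum>j<n. b j * cos (real j * \<theta>))}"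

lemma cos_polys_add:
  assumes "\<sigma> \<in> cos_polys n" "\<rho> \<in> cos_polys n"
  shows "(\<lambda>\<theta>. \<sigma> \<theta> + \<rho> \<theta>) \<in> cos_polys n"
proof -
  obtain b b' where "\<And>\<theta>. \<sigma> \<theta> = (\<Sum>j<n. b j * cos (real j * \<theta>))"
      "\<And>\<theta>. \<rho> \<theta> = (\<Sum>j<n. b' j * cos (real j * \<theta>))"
    using assms by (auto simp: cos_polys_def)
  then show ?thesis unfolding cos_polys_def
    by (intro CollectI exI[of _ "\<lambda>j. b j + b' j"]) (simp add: sum.distrib algebra_simps)
qed

lemma cos_polys_cmult:
  assumes "\<sigma> \<in> cos_polys n"
  shows "(\<lambda>\<theta>. c * \<sigma> \<theta>) \<in> cos_polys n"
proof -
  obtain b where "\<And>\<theta>. \<sigma> \<theta> = (\<Sum>j<n. b j * cos (real j * \<theta>))"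
    using assms by (auto simp: cos_polys_def)
  then show ?thesis unfolding cos_polys_def
    by (intro CollectI exI[of _ "\<lambda>j. c * b j"]) (simp add: sum_distrib_left algebra_simps)
qed

lemma cos_polys_mono:
  assumes "\<sigma> \<in> cos_polys m" "m \<le> n"
  shows "\<sigma> \<in> cos_polys n"
proof -
  obtain b where b: "\<And>\<theta>. \<sigma> \<theta> = (\<Sum>j<m. b j * cos (real j * \<theta>))"
    using assms by (auto simp: cos_polys_def)
  have "\<sigma> \<theta> = (\<Sum>j<n. (if j < m then b j else 0) * cos (real j * \<theta>))" for \<theta>
    unfolding b using assms(2) by (intro sum.mono_neutral_cong_left) auto
  then show ?thesis unfolding cos_polys_def by (intro CollectI exI allI)
qed

lemma cos_polys_cos: "j < n \<Longrightarrow> (\<lambda>\<theta>. cos (real j * \<theta>)) \<in> cos_polys n"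
  unfolding cos_polys_def
  by (intro CollectI exI[of _ "\<lambda>i. if i = j then 1 else 0"]) (simp add: if_distrib[of "\<lambda>x. x * _"] cong: if_cong)

lemma cos_polys_sum:
  assumes "finite I" "\<And>i. i \<in> I \<Longrightarrow> \<sigma> i \<in> cos_polys n"
  shows "(\<lambda>\<theta>. \<Sum>i\<in>I. \<sigma> i \<theta>) \<in> cos_polys n"
  using assms
proof (induction I rule: finite_induct)
  case empty
  show ?case unfolding cos_polys_def by (intro CollectI exI[of _ "\<lambda>_. 0"]) simp
next
  case (insert x F)
  then show ?case by (simp add: cos_polys_add)
qed

lemma cos_polys_mult_cos:
  assumes "\<sigma> \<in> cos_polys n"
  shows "(\<lambda>\<theta>. cos \<theta> * \<sigma> \<theta>) \<in> cos_polys (Suc n)"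
proof -
  obtain b where b: "\<And>\<theta>. \<sigma> \<theta> = (\<Sum>j<n. b j * cos (real j * \<theta>))"
    using assms by (auto simp: cos_polys_def)
  have m: "(\<lambda>\<theta>. cos \<theta> * cos (real j * \<theta>)) \<in> cos_polys (Suc n)" if "j < n" for j
  proof (cases j)
    case 0
    have "(\<lambda>\<theta>. cos (real 1 * \<theta>)) \<in> cos_polys (Suc n)" using that by (intro cos_polys_cos) auto
    then show ?thesis using 0 by simp
  next
    case (Suc i)
    have "cos \<theta> * cos (real j * \<theta>) = 1/2 * cos (real (Suc j) * \<theta>) + 1/2 * cos (real i * \<theta>)" for \<theta>
      using cos_times_cos[of "real j * \<theta>" \<theta>] by (simp add: Suc algebra_simps)
    moreover have "(\<lambda>\<theta>. 1/2 * cos (real (Suc j) * \<theta>) + 1/2 * cos (real i * \<theta>)) \<in> cos_polys (Suc n)"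
      using that Suc by (intro cos_polys_add cos_polys_cmult cos_polys_cos) auto
    ultimately show ?thesis by simp
  qed
  have "(\<lambda>\<theta>. \<Sum>j<n. b j * (cos \<theta> * cos (real j * \<theta>))) \<in> cos_polys (Suc n)"
    by (intro cos_polys_sum cos_polys_cmult m) auto
  moreover have "(\<lambda>\<theta>. \<Sum>j<n. b j * (cos \<theta> * cos (real j * \<theta>))) = (\<lambda>\<theta>. cos \<theta> * \<sigma> \<theta>)"
    by (auto simp: b sum_distrib_left mult_ac)
  ultimately show ?thesis by simp
qed

lemma cos_polys_prod:
  "(\<lambda>\<theta>. \<Prod>i<n. x i - cos \<theta>) \<in> cos_polys (Suc n)"
proof (induction n)
  case 0
  show ?case using cos_polys_cos[of 0 1] by simp
next
  case (Suc n)
  have "(\<lambda>\<theta>. x n * (\<Prod>i<n. x i - cos \<theta>) + (-1) * (cos \<theta> * (\<Prod>i<n. x i - cos \<theta>)))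
      \<in> cos_polys (Suc (Suc n))"
    by (intro cos_polys_add cos_polys_cmult cos_polys_mult_cos Suc)
       (rule cos_polys_mono[OF Suc], simp)
  then show ?case by (simp add: algebra_simps)
qed

text \<open>Dividing successively by the \<open>n\<close> linear factors \<open>u - (1 - x i) = x i - cos \<theta>\<close> yields a cosine
  polynomial that interpolates \<open>\<theta>\<^sup>2\<close> at the angles \<open>arccos (x i)\<close>, together with the sign of the error:
  since \<open>q\<close> is nonnegative, the error changes sign exactly where the product does.\<close>

lemma angle_square_interpolation:
  fixes x :: "nat \<Rightarrow> real"
  assumes "\<And>i. i < n \<Longrightarrow> -1 < x i \<and> x i \<le> 1"
  shows "\<exists>\<sigma>\<in>cos_polys n. \<exists>q. nonneg_power_series 2 q \<and>
           (\<forall>\<theta>\<in>{0..<pi}. \<theta>\<^sup>2 = \<sigma> \<theta> + (\<Prod>i<n. x i - cos \<theta>) * q (1 - cos \<theta>))"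
  using assms
proof (induction n)
  case 0
  have z: "(\<lambda>\<theta>. 0) \<in> cos_polys 0" by (simp add: cos_polys_def)
  show ?case
    by (intro bexI[OF _ z] exI[of _ "\<lambda>u. (arccos (1 - u))\<^sup>2"] conjI angle_square_series)
       (simp add: arccos_cos)
next
  case (Suc n)
  have "\<exists>\<sigma>\<in>cos_polys n. \<exists>q. nonneg_power_series 2 q \<and>
           (\<forall>\<theta>\<in>{0..<pi}. \<theta>\<^sup>2 = \<sigma> \<theta> + (\<Prod>i<n. x i - cos \<theta>) * q (1 - cos \<theta>))"
    by (rule Suc.IH) (use Suc.prems in auto)
  then obtain \<sigma> q where \<sigma>: "\<sigma> \<in> cos_polys n" and q: "nonneg_power_series 2 q"
    and eq: "\<And>\<theta>. \<theta> \<in> {0..<pi} \<Longrightarrow> \<theta>\<^sup>2 = \<sigma> \<theta> + (\<Prod>i<n. x i - cos \<theta>) * q (1 - cos \<theta>)"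
    by blast
  define a where "a = 1 - x n"
  have a: "0 \<le> a" "a < 2" using Suc.prems[of n] by (auto simp: a_def)
  obtain q' where q': "nonneg_power_series 2 q'"
    and s: "\<And>u. 0 \<le> u \<Longrightarrow> u < 2 \<Longrightarrow> q u = q a + (u - a) * q' u"
    using nonneg_power_series_divide_linear[OF q a] by blast
  have mem: "(\<lambda>\<theta>. \<sigma> \<theta> + q a * (\<Prod>i<n. x i - cos \<theta>)) \<in> cos_polys (Suc n)"
    by (intro cos_polys_add cos_polys_cmult cos_polys_prod cos_polys_mono[OF \<sigma>]) simp
  have "\<theta>\<^sup>2 = \<sigma> \<theta> + q a * (\<Prod>i<n. x i - cos \<theta>) + (\<Prod>i<Suc n. x i - cos \<theta>) * q' (1 - cos \<theta>)"
    if t: "\<theta> \<in> {0..<pi}" for \<theta>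
  proof -
    have "q (1 - cos \<theta>) = q a + (x n - cos \<theta>) * q' (1 - cos \<theta>)"
      using s[of "1 - cos \<theta>"] cos_monotone_0_pi[of \<theta> pi] t by (simp add: a_def)
    then show ?thesis by (simp only: eq[OF t]) (simp add: algebra_simps)
  qed
  then show ?case by (intro bexI[OF _ mem] exI[of _ q'] conjI q' ballI)
qed

section \<open>The kernel of extremal sign\<close>

text \<open>The zeros of \<open>cos (n * \<theta>)\<close> in \<open>(0, \<pi>)\<close>, for \<open>k = 1, \<dots>, n\<close>.\<close>

definition node :: "nat \<Rightarrow> nat \<Rightarrow> real" where
  "node n k = (2 * real k - 1) * pi / (2 * real n)"

text \<open>The next three lemmas evaluate, on \<open>\<theta>\<close>, \<open>\<theta>\<^sup>3\<close> and \<open>sin (j * \<theta>)\<close>, the alternating sum over the nodes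
  that arises when a function is integrated against the sign of \<open>cos (n * \<theta>)\<close>. The first and the last
  together say that this sign is orthogonal to the cosine polynomials of degree less than \<open>n\<close>.\<close>

lemma alternating_sum_nodes:
  "(\<Sum>k=1..n. (-1) ^ k * (2 * real k - 1)) = (-1) ^ n * real n"
  by (induction n) (auto simp: algebra_simps)

lemma alternating_sum_node_cubes:
  "(\<Sum>k=1..n. (-1) ^ k * (2 * real k - 1) ^ 3) = (-1) ^ n * (4 * real n ^ 3 - 3 * real n)"
  by (induction n) (auto simp: algebra_simps power3_eq_cube)

lemma alternating_sum_node_sines:
  assumes "j < n"
  shows "(\<Sum>k=1..n. (-1) ^ k * sin (real j * node n k)) = 0"
proof -
  define a where "a = real j * pi / (2 * real n)"
  have "2 * cos a * (\<Sum>k=1..m. (-1) ^ k * sin ((2 * real k - 1) * a)) = (-1) ^ m * sin (2 * real m * a)" for m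
  proof (induction m)
    case (Suc m)
    have "2 * cos a * sin ((2 * real (Suc m) - 1) * a) = sin (2 * real (Suc m) * a) + sin (2 * real m * a)"
      using sin_times_cos[of "(2 * real (Suc m) - 1) * a" a] by (simp add: algebra_simps)
    then have "2 * cos a * ((-1) ^ Suc m * sin ((2 * real (Suc m) - 1) * a))
        = (-1) ^ Suc m * (sin (2 * real (Suc m) * a) + sin (2 * real m * a))"
      by (metis mult.left_commute)
    moreover have "(\<Sum>k=1..Suc m. (-1) ^ k * sin ((2 * real k - 1) * a))
        = (\<Sum>k=1..m. (-1) ^ k * sin ((2 * real k - 1) * a))
          + (-1) ^ Suc m * sin ((2 * real (Suc m) - 1) * a)"
      by simp
    ultimately have "2 * cos a * (\<Sum>k=1..Suc m. (-1) ^ k * sin ((2 * real k - 1) * a))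
        = (-1) ^ m * sin (2 * real m * a) + (-1) ^ Suc m * (sin (2 * real (Suc m) * a) + sin (2 * real m * a))"
      using Suc by (simp only: distrib_left)
    then show ?case by (simp only: power_Suc) (simp add: algebra_simps)
  qed simp
  from this[of n] have "2 * cos a * (\<Sum>k=1..n. (-1) ^ k * sin ((2 * real k - 1) * a)) = 0"
    using assms by (simp add: a_def)
  moreover have "cos a > 0"
    using assms by (intro cos_gt_zero_pi) (auto simp: a_def field_simps intro: less_le_trans[of _ 0])
  moreover have "real j * node n k = (2 * real k - 1) * a" for k
    by (simp add: node_def a_def)
  ultimately show ?thesis by simp
qed

lemma node_pos: "1 \<le> k \<Longrightarrow> 1 \<le> n \<Longrightarrow> 0 < node n k"
  by (simp add: node_def)

lemma node_less_pi: "k \<le> n \<Longrightarrow> 1 \<le> n \<Longrightarrow> node n k < pi"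
  using mult_strict_right_mono[of "2 * real k - 1" "2 * real n" pi]
  by (simp add: node_def pos_divide_less_eq mult_ac)

lemma node_mono: "i \<le> k \<Longrightarrow> node n i \<le> node n k"
  by (auto simp: node_def intro!: divide_right_mono mult_right_mono)

lemma prod_alternating_sign:
  fixes y :: "nat \<Rightarrow> real"
  assumes "k \<le> n" "\<And>i. i < k \<Longrightarrow> y i \<ge> 0" "\<And>i. k \<le> i \<Longrightarrow> i < n \<Longrightarrow> y i \<le> 0"
  shows "(-1) ^ (n + k) * (\<Prod>i<n. y i) \<ge> 0"
  using assms
proof (induction n rule: nat_induct_at_least)
  case base
  then show ?case by (auto intro!: prod_nonneg simp: power_add)
next
  case (Suc n)
  have "(-1) ^ (n + k) * (\<Prod>i<n. y i) \<ge> 0" using Suc by auto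
  moreover have "- y n \<ge> 0" using Suc by auto
  ultimately have "((-1) ^ (n + k) * (\<Prod>i<n. y i)) * - y n \<ge> 0" by (rule mult_nonneg_nonneg)
  then show ?case by (simp add: mult_ac)
qed

text \<open>The cosine polynomial \<open>\<sigma>\<close> interpolates \<open>\<theta>\<^sup>2\<close> at the zeros of \<open>cos (n * \<theta>)\<close>. By the interpolation
  lemma \<open>\<theta>\<^sup>2 - \<sigma> \<theta>\<close> changes sign exactly there, so the integral of its absolute value is an
  alternating sum \<open>\<Lambda> H\<close> of values of an antiderivative \<open>H\<close>. The contribution of \<open>\<sigma>\<close> to \<open>\<Lambda> H\<close> vanishes by
  orthogonality, and the contribution of \<open>\<theta>\<^sup>3 / 3\<close> is explicit. This exact value is what makes the constant in
  Favard's inequality sharp.\<close>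

lemma favard_kernel_L1_norm:
  assumes n: "n \<ge> 1"
  shows "\<exists>\<sigma>\<in>cos_polys n. ((\<lambda>\<theta>. \<bar>\<theta>\<^sup>2 - \<sigma> \<theta>\<bar>) has_integral pi ^ 3 / (4 * real n ^ 2)) {0..pi}"
proof -
  define x where "x = (\<lambda>i. cos (node n (Suc i)))"
  have "-1 < x i \<and> x i \<le> 1" if "i < n" for i
    using cos_monotone_0_pi[of "node n (Suc i)" pi] node_pos[of "Suc i" n] node_less_pi[of "Suc i" n] that n
    by (simp add: x_def)
  then obtain \<sigma> q where \<sigma>: "\<sigma> \<in> cos_polys n" and q: "nonneg_power_series 2 q"
    and eq: "\<And>\<theta>. \<theta> \<in> {0..<pi} \<Longrightarrow> \<theta>\<^sup>2 = \<sigma> \<theta> + (\<Prod>i<n. x i - cos \<theta>) * q (1 - cos \<theta>)"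
    using angle_square_interpolation[of n x] by blast
  obtain b where b: "\<And>\<theta>. \<sigma> \<theta> = (\<Sum>j<n. b j * cos (real j * \<theta>))"
    using \<sigma> by (auto simp: cos_polys_def)
  \<comment> \<open>Antiderivatives of the functions \<open>cos (j * \<theta>)\<close> that vanish at \<open>0\<close>, and of \<open>\<theta>\<^sup>2 - \<sigma> \<theta>\<close>.\<close>
  define S where "S = (\<lambda>j \<theta>. if j = 0 then \<theta> else sin (real j * \<theta>) / real j)"
  define H where "H = (\<lambda>\<theta>. \<theta> ^ 3 / 3 - (\<Sum>j<n. b j * S j \<theta>))"
  have dS: "(S j has_real_derivative cos (real j * \<theta>)) (at \<theta>)" for j \<theta>
    by (cases "j = 0") (auto simp: S_def intro!: derivative_eq_intros)
  have dH: "(H has_real_derivative \<theta>\<^sup>2 - \<sigma> \<theta>) (at \<theta>)" for \<theta>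
    unfolding H_def b by (auto intro!: derivative_eq_intros dS simp: mult.commute)
  \<comment> \<open>The \<open>n + 1\<close> intervals \<open>[p k, p (k+1)]\<close>, \<open>k \<le> n\<close>, on which the sign of the error is constant.\<close>
  define p where "p = (\<lambda>k. if k = 0 then 0 else if k \<le> n then node n k else pi)"
  have p_step: "p k \<le> p (Suc k)" for k
    using node_pos[of "Suc k" n] node_mono[of k "Suc k" n] node_less_pi[of k n] n
    by (auto simp: p_def)
  have p_range: "0 \<le> p k" "p k \<le> pi" for k
    using node_pos[of k n] node_less_pi[of k n] n by (auto simp: p_def less_imp_le)
  have sign: "(-1) ^ (n + k) * (\<theta>\<^sup>2 - \<sigma> \<theta>) \<ge> 0"
    if k: "k \<le> n" and t: "p k \<le> \<theta>" "\<theta> \<le> p (Suc k)" "\<theta> \<noteq> pi" for k \<theta>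
  proof -
    have t': "0 \<le> \<theta>" "\<theta> < pi" using t p_range[of k] p_range[of "Suc k"] by auto
    have "(-1) ^ (n + k) * (\<Prod>i<n. x i - cos \<theta>) \<ge> 0"
    proof (rule prod_alternating_sign[OF k])
      fix i assume i: "i < k"
      then have "node n (Suc i) \<le> \<theta>" using node_mono[of "Suc i" k n] t k by (auto simp: p_def)
      then show "x i - cos \<theta> \<ge> 0"
        using cos_monotone_0_pi_le[of "node n (Suc i)" \<theta>] t' node_pos[of "Suc i" n] n by (simp add: x_def)
    next
      fix i assume i: "k \<le> i" "i < n"
      then have "\<theta> \<le> node n (Suc i)" using node_mono[of "Suc k" "Suc i" n] t by (auto simp: p_def)
      then show "x i - cos \<theta> \<le> 0"
        using cos_monotone_0_pi_le[of \<theta> "node n (Suc i)"] t' node_less_pi[of "Suc i" n] n i by (simp add: x_def)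
    qed
    moreover have "q (1 - cos \<theta>) \<ge> 0"
      using nonneg_power_series_nonneg[OF q, of "1 - cos \<theta>"] cos_monotone_0_pi[of \<theta> pi] t' by simp
    ultimately have "((-1) ^ (n + k) * (\<Prod>i<n. x i - cos \<theta>)) * q (1 - cos \<theta>) \<ge> 0"
      by (rule mult_nonneg_nonneg)
    then show ?thesis using eq[of \<theta>] t' by (simp add: mult_ac)
  qed
  have piece: "((\<lambda>\<theta>. \<bar>\<theta>\<^sup>2 - \<sigma> \<theta>\<bar>) has_integral (-1) ^ (n + k) * (H (p (Suc k)) - H (p k))) {p k..p (Suc k)}"
    if k: "k \<le> n" for k
  \<comment> \<open>The power series does not reach \<open>u = 2\<close>, so the sign at the end point \<open>\<pi>\<close> is not known.\<close>
  proof (rule has_integral_spike_finite[of "{pi}"])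
    show "((\<lambda>\<theta>. (-1) ^ (n + k) * (\<theta>\<^sup>2 - \<sigma> \<theta>)) has_integral (-1) ^ (n + k) * (H (p (Suc k)) - H (p k)))
       {p k..p (Suc k)}"
      by (intro has_integral_mult_right fundamental_theorem_of_calculus p_step)
         (use dH in \<open>auto simp: has_real_derivative_iff_has_vector_derivative[symmetric] intro: has_field_derivative_at_within\<close>)
  next
    fix \<theta> assume "\<theta> \<in> {p k..p (Suc k)} - {pi}"
    then have "(-1) ^ (n + k) * (\<theta>\<^sup>2 - \<sigma> \<theta>) \<ge> 0" using sign[OF k] by auto
    then have "(-1) ^ (n + k) * (\<theta>\<^sup>2 - \<sigma> \<theta>) = \<bar>(-1) ^ (n + k) * (\<theta>\<^sup>2 - \<sigma> \<theta>)\<bar>" by simp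
    then show "\<bar>\<theta>\<^sup>2 - \<sigma> \<theta>\<bar> = (-1) ^ (n + k) * (\<theta>\<^sup>2 - \<sigma> \<theta>)" by (simp add: abs_mult)
  qed auto
  define \<Lambda> where "\<Lambda> = (\<lambda>h :: real \<Rightarrow> real. h pi - 2 * (-1) ^ n * (\<Sum>k=1..n. (-1) ^ k * h (node n k)))"
  have "((\<lambda>\<theta>. \<bar>\<theta>\<^sup>2 - \<sigma> \<theta>\<bar>) has_integral
      (-1) ^ (n + m) * H (p (Suc m)) - 2 * (-1) ^ n * (\<Sum>k=1..m. (-1) ^ k * H (node n k))) {0..p (Suc m)}"
    if "m \<le> n" for m
    using that
  proof (induction m)
    case 0
    have "S j 0 = 0" for j by (simp add: S_def)
    then have "H 0 = 0" by (simp add: H_def)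
    moreover have "p 0 = 0" by (simp add: p_def)
    ultimately show ?case using piece[of 0] by simp
  next
    case (Suc m)
    have "((\<lambda>\<theta>. \<bar>\<theta>\<^sup>2 - \<sigma> \<theta>\<bar>) has_integral
      ((-1) ^ (n + m) * H (p (Suc m)) - 2 * (-1) ^ n * (\<Sum>k=1..m. (-1) ^ k * H (node n k)))
       + (-1) ^ (n + Suc m) * (H (p (Suc (Suc m))) - H (p (Suc m)))) {0..p (Suc (Suc m))}"
      using Suc by (intro has_integral_combine[OF p_range(1) p_step] piece) auto
    moreover have "p (Suc m) = node n (Suc m)" using Suc by (simp add: p_def)
    ultimately show ?case by (simp add: algebra_simps power_add)
  qed
  from this[of n] have "((\<lambda>\<theta>. \<bar>\<theta>\<^sup>2 - \<sigma> \<theta>\<bar>) has_integral \<Lambda> H) {0..pi}"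
    by (simp add: p_def \<Lambda>_def power_add[symmetric] mult_2[symmetric])
  moreover have "\<Lambda> H = pi ^ 3 / (4 * real n ^ 2)"
  proof -
    have S0: "\<Lambda> (S j) = 0" if "j < n" for j
    proof (cases "j = 0")
      case True
      have "(\<Sum>k=1..n. (-1) ^ k * S j (node n k)) = pi / (2 * real n) * (\<Sum>k=1..n. (-1) ^ k * (2 * real k - 1))"
        unfolding sum_distrib_left by (intro sum.cong refl) (simp add: S_def True node_def)
      then have "\<Lambda> (S j) = pi - 2 * ((-1) ^ n * (-1) ^ n) * (pi / (2 * real n) * real n)"
        unfolding \<Lambda>_def alternating_sum_nodes by (simp add: S_def True)
      then show ?thesis using n by (simp flip: power_mult_distrib)
    next
      case False
      have "(\<Sum>k=1..n. (-1) ^ k * S j (node n k)) = 1 / real j * (\<Sum>k=1..n. (-1) ^ k * sin (real j * node n k))"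
        unfolding sum_distrib_left by (intro sum.cong refl) (simp add: S_def False)
      then show ?thesis using alternating_sum_node_sines[OF that] False by (simp add: \<Lambda>_def S_def)
    qed
    define Z where "Z = (\<lambda>j. \<Sum>k=1..n. (-1) ^ k * S j (node n k))"
    have "(\<Sum>k=1..n. (-1) ^ k * H (node n k))
        = (\<Sum>k=1..n. (-1) ^ k * (node n k ^ 3 / 3)) - (\<Sum>k=1..n. \<Sum>j<n. b j * ((-1) ^ k * S j (node n k)))"
      by (simp add: H_def right_diff_distrib sum_subtractf sum_distrib_left mult_ac)
    also have "(\<Sum>k=1..n. \<Sum>j<n. b j * ((-1) ^ k * S j (node n k))) = (\<Sum>j<n. b j * Z j)"
      unfolding Z_def by (subst sum.swap) (simp add: sum_distrib_left)
    finally have HZ: "(\<Sum>k=1..n. (-1) ^ k * H (node n k))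
        = (\<Sum>k=1..n. (-1) ^ k * (node n k ^ 3 / 3)) - (\<Sum>j<n. b j * Z j)" .
    have "\<Lambda> (S j) = S j pi - 2 * (-1) ^ n * Z j" for j by (simp add: \<Lambda>_def Z_def)
    then have "(\<Sum>j<n. b j * \<Lambda> (S j)) = (\<Sum>j<n. b j * S j pi) - 2 * (-1) ^ n * (\<Sum>j<n. b j * Z j)"
      by (simp add: right_diff_distrib sum_subtractf sum_distrib_left mult_ac)
    then have "\<Lambda> H = \<Lambda> (\<lambda>\<theta>. \<theta> ^ 3 / 3) - (\<Sum>j<n. b j * \<Lambda> (S j))"
      unfolding \<Lambda>_def HZ by (simp add: H_def right_diff_distrib)
    also have "(\<Sum>j<n. b j * \<Lambda> (S j)) = 0" using S0 by simp
    finally have red: "\<Lambda> H = \<Lambda> (\<lambda>\<theta>. \<theta> ^ 3 / 3)" by simp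
    have cubes: "(\<Sum>k=1..n. (-1) ^ k * (node n k ^ 3 / 3))
       = (pi / (2 * real n)) ^ 3 / 3 * (\<Sum>k=1..n. (-1) ^ k * (2 * real k - 1) ^ 3)"
      unfolding sum_distrib_left by (intro sum.cong refl) (simp add: node_def power_mult_distrib power_divide)
    have "\<Lambda> (\<lambda>\<theta>. \<theta> ^ 3 / 3)
        = pi ^ 3 / 3 - 2 * ((-1) ^ n * (-1) ^ n) * ((pi / (2 * real n)) ^ 3 / 3 * (4 * real n ^ 3 - 3 * real n))"
      unfolding \<Lambda>_def cubes alternating_sum_node_cubes by (simp only: mult_ac)
    also have "(-1 :: real) ^ n * (-1) ^ n = 1" by (simp flip: power_mult_distrib)
    also have "pi ^ 3 / 3 - 2 * 1 * ((pi / (2 * real n)) ^ 3 / 3 * (4 * real n ^ 3 - 3 * real n)) = pi ^ 3 / (4 * real n ^ 2)"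
      using n by (simp add: field_simps power3_eq_cube power2_eq_square)
    finally show ?thesis unfolding red .
  qed
  ultimately show ?thesis using \<sigma> by auto
qed

section \<open>Trigonometric polynomials and periodic integrals\<close>

lemma trig_polys_add:
  assumes "\<tau> \<in> trig_polys m" "\<rho> \<in> trig_polys m"
  shows "(\<lambda>x. \<tau> x + \<rho> x) \<in> trig_polys m"
proof -
  obtain a b a' b' where
    "\<And>x. \<tau> x = (\<Sum>k\<le>m. a k * cos (real k * x) + b k * sin (real k * x))"
    "\<And>x. \<rho> x = (\<Sum>k\<le>m. a' k * cos (real k * x) + b' k * sin (real k * x))"
    using assms by (auto simp: trig_polys_def)
  then have "\<tau> x + \<rho> x = (\<Sum>k\<le>m. (a k + a' k) * cos (real k * x) + (b k + b' k) * sin (real k * x))" for x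
    by (simp add: sum.distrib algebra_simps)
  then show ?thesis unfolding trig_polys_def by (intro CollectI exI allI)
qed

lemma trig_polys_cmult:
  assumes "\<tau> \<in> trig_polys m"
  shows "(\<lambda>x. c * \<tau> x) \<in> trig_polys m"
proof -
  obtain a b where
    "\<And>x. \<tau> x = (\<Sum>k\<le>m. a k * cos (real k * x) + b k * sin (real k * x))"
    using assms by (auto simp: trig_polys_def)
  then have "c * \<tau> x = (\<Sum>k\<le>m. (c * a k) * cos (real k * x) + (c * b k) * sin (real k * x))" for x
    by (simp add: sum_distrib_left algebra_simps)
  then show ?thesis unfolding trig_polys_def by (intro CollectI exI allI)
qed

lemma trig_polys_diff:
  assumes "\<tau> \<in> trig_polys m" "\<rho> \<in> trig_polys m"
  shows "(\<lambda>x. \<tau> x - \<rho> x) \<in> trig_polys m"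
  using trig_polys_add[OF assms(1) trig_polys_cmult[OF assms(2), of "-1"]] by simp

lemma trig_polys_harmonic:
  assumes "j \<le> m"
  shows "(\<lambda>x. A * cos (real j * x) + B * sin (real j * x)) \<in> trig_polys m"
proof -
  have "A * cos (real j * x) + B * sin (real j * x)
      = (\<Sum>k\<le>m. (if k = j then A else 0) * cos (real k * x) + (if k = j then B else 0) * sin (real k * x))" for x
  proof -
    have "(\<Sum>k\<le>m. (if k = j then A else 0) * cos (real k * x) + (if k = j then B else 0) * sin (real k * x))
       = (\<Sum>k\<le>m. if k = j then A * cos (real k * x) + B * sin (real k * x) else 0)"
      by (intro sum.cong) auto
    then show ?thesis using assms by simp
  qed
  then show ?thesis unfolding trig_polys_def by (intro CollectI exI allI)
qed

lemma trig_polys_const: "(\<lambda>x. c) \<in> trig_polys m"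
  using trig_polys_harmonic[of 0 m c 0] by simp

lemma trig_polys_sum:
  assumes "finite I" "\<And>i. i \<in> I \<Longrightarrow> \<tau> i \<in> trig_polys m"
  shows "(\<lambda>x. \<Sum>i\<in>I. \<tau> i x) \<in> trig_polys m"
  using assms
proof (induction I rule: finite_induct)
  case empty
  then show ?case using trig_polys_const[of 0] by simp
next
  case (insert x F)
  then show ?case by (simp add: trig_polys_add)
qed

lemma trig_polys_shift:
  assumes "\<tau> \<in> trig_polys m"
  shows "(\<lambda>x. \<tau> (x - c)) \<in> trig_polys m"
proof -
  obtain a b where \<tau>:
    "\<And>x. \<tau> x = (\<Sum>k\<le>m. a k * cos (real k * x) + b k * sin (real k * x))"
    using assms by (auto simp: trig_polys_def)
  have "\<tau> (x - c) = (\<Sum>k\<le>m. (a k * cos (real k * c) - b k * sin (real k * c)) * cos (real k * x)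
      + (a k * sin (real k * c) + b k * cos (real k * c)) * sin (real k * x))" for x
    unfolding \<tau> by (intro sum.cong refl) (simp add: right_diff_distrib cos_diff sin_diff algebra_simps)
  then show ?thesis unfolding trig_polys_def by (intro CollectI exI allI)
qed

lemma continuous_has_antiderivative:
  fixes g :: "real \<Rightarrow> real"
  assumes "continuous_on UNIV g"
  shows "\<exists>G. \<forall>x. (G has_real_derivative g x) (at x)"
proof -
  have "\<exists>F. \<forall>x::real. -\<infinity> < ereal x \<longrightarrow> ereal x < \<infinity> \<longrightarrow> (F has_vector_derivative g x) (at x)"
    by (rule einterval_antiderivative)
       (use assms in \<open>auto simp: continuous_on_eq_continuous_at\<close>)
  then obtain F where "\<And>x. (F has_vector_derivative g x) (at x)" by auto
  then show ?thesis
    by (intro exI[of _ F]) (simp add: has_real_derivative_iff_has_vector_derivative)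
qed

lemma has_real_derivative_zero_const:
  fixes D :: "real \<Rightarrow> real"
  assumes "\<And>x. (D has_real_derivative 0) (at x)"
  shows "D x = D y"
  using DERIV_isconst_all[of D x y] assms by blast

lemma periodic_antiderivative_increment:
  fixes G g :: "real \<Rightarrow> real"
  assumes dG: "\<And>x. (G has_real_derivative g x) (at x)" and g: "\<And>x. g (x + 2 * pi) = g x"
  shows "\<exists>c. \<forall>y. G (y + pi) - G (y - pi) = c"
proof -
  have "((\<lambda>y. G (y + pi) - G (y - pi)) has_real_derivative 0) (at y)" for y
    using g[of "y - pi"] by (auto intro!: derivative_eq_intros DERIV_chain2[OF dG] simp: add.commute)
  from has_real_derivative_zero_const[OF this, of _ 0] show ?thesis
    by (intro exI allI)
qed

text \<open>The coefficients \<open>A\<close> and \<open>B\<close> are the integrals of \<open>g v\<close> against \<open>cos (j * v)\<close> and \<open>sin (j * v)\<close> over a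
  period. They come from writing \<open>\<theta>\<close> as the difference of \<open>y + \<theta>\<close> and \<open>y\<close> (and of \<open>y\<close> and \<open>y - \<theta>\<close>) in
  the addition theorem.\<close>

lemma cos_convolution:
  fixes g :: "real \<Rightarrow> real"
  assumes g: "continuous_on UNIV g" "\<And>x. g (x + 2 * pi) = g x"
  shows "\<exists>A B. \<forall>y. ((\<lambda>\<theta>. cos (real j * \<theta>) * (g (y + \<theta>) + g (y - \<theta>))) has_integral
            A * cos (real j * y) + B * sin (real j * y)) {0..pi}"
proof -
  have per: "cos (real j * (x + 2 * pi)) = cos (real j * x)" "sin (real j * (x + 2 * pi)) = sin (real j * x)" for x
    using cos_2npi[of j] sin_2npi[of j] by (simp_all add: distrib_left cos_add sin_add mult_ac)
  have "continuous_on UNIV (\<lambda>v. cos (real j * v) * g v)" "continuous_on UNIV (\<lambda>v. sin (real j * v) * g v)"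
    by (intro continuous_intros g)+
  note cont = this
  obtain C where C: "\<And>x. (C has_real_derivative cos (real j * x) * g x) (at x)"
    using continuous_has_antiderivative[OF cont(1)] by auto
  obtain S where S: "\<And>x. (S has_real_derivative sin (real j * x) * g x) (at x)"
    using continuous_has_antiderivative[OF cont(2)] by auto
  obtain A where A: "\<And>y. C (y + pi) - C (y - pi) = A"
    using periodic_antiderivative_increment[OF C] by (auto simp only: per g(2))
  obtain B where B: "\<And>y. S (y + pi) - S (y - pi) = B"
    using periodic_antiderivative_increment[OF S] by (auto simp only: per g(2))
  have "((\<lambda>\<theta>. cos (real j * \<theta>) * (g (y + \<theta>) + g (y - \<theta>))) has_integral
            A * cos (real j * y) + B * sin (real j * y)) {0..pi}" for y
  proof -
    define Q where "Q = (\<lambda>\<theta>. (C (y + \<theta>) - C (y - \<theta>)) * cos (real j * y) + (S (y + \<theta>) - S (y - \<theta>)) * sin (real j * y))"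
    have "(Q has_real_derivative cos (real j * \<theta>) * (g (y + \<theta>) + g (y - \<theta>))) (at \<theta>)" for \<theta>
    proof -
      have 1: "cos (real j * \<theta>) = cos (real j * (y + \<theta>)) * cos (real j * y) + sin (real j * (y + \<theta>)) * sin (real j * y)"
        using cos_diff[of "real j * (y + \<theta>)" "real j * y"] by (simp add: algebra_simps)
      have 2: "cos (real j * \<theta>) = cos (real j * (y - \<theta>)) * cos (real j * y) + sin (real j * (y - \<theta>)) * sin (real j * y)"
        using cos_diff[of "real j * y" "real j * (y - \<theta>)"] by (simp add: algebra_simps)
      have "(Q has_real_derivative
          (cos (real j * (y + \<theta>)) * g (y + \<theta>) + cos (real j * (y - \<theta>)) * g (y - \<theta>)) * cos (real j * y)
          + (sin (real j * (y + \<theta>)) * g (y + \<theta>) + sin (real j * (y - \<theta>)) * g (y - \<theta>)) * sin (real j * y)) (at \<theta>)"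
        unfolding Q_def by (auto intro!: derivative_eq_intros DERIV_chain2[OF C] DERIV_chain2[OF S])
      also have "(cos (real j * (y + \<theta>)) * g (y + \<theta>) + cos (real j * (y - \<theta>)) * g (y - \<theta>)) * cos (real j * y)
          + (sin (real j * (y + \<theta>)) * g (y + \<theta>) + sin (real j * (y - \<theta>)) * g (y - \<theta>)) * sin (real j * y)
          = cos (real j * \<theta>) * g (y + \<theta>) + cos (real j * \<theta>) * g (y - \<theta>)"
        by (subst 1, subst 2) (simp only: distrib_left distrib_right mult_ac add_ac)
      finally show ?thesis by (simp only: distrib_left)
    qed
    then have "((\<lambda>\<theta>. cos (real j * \<theta>) * (g (y + \<theta>) + g (y - \<theta>))) has_integral Q pi - Q 0) {0..pi}"
      by (intro fundamental_theorem_of_calculus)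
         (auto simp: has_real_derivative_iff_has_vector_derivative[symmetric] intro: has_field_derivative_at_within)
    then show ?thesis by (simp add: Q_def A B)
  qed
  then show ?thesis by blast
qed

lemma cos_polys_convolution:
  fixes g :: "real \<Rightarrow> real"
  assumes g: "continuous_on UNIV g" "\<And>x. g (x + 2 * pi) = g x"
    and n: "n \<ge> 1" and \<sigma>: "\<sigma> \<in> cos_polys n"
  shows "\<exists>\<tau>\<in>trig_polys (n - 1). \<forall>y. ((\<lambda>\<theta>. \<sigma> \<theta> * (g (y + \<theta>) + g (y - \<theta>))) has_integral \<tau> y) {0..pi}"
proof -
  obtain b where b: "\<And>\<theta>. \<sigma> \<theta> = (\<Sum>j<n. b j * cos (real j * \<theta>))"
    using \<sigma> by (auto simp: cos_polys_def)
  have "\<forall>j. \<exists>A B. \<forall>y. ((\<lambda>\<theta>. cos (real j * \<theta>) * (g (y + \<theta>) + g (y - \<theta>))) has_integral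
            A * cos (real j * y) + B * sin (real j * y)) {0..pi}"
    using cos_convolution[OF g] by blast
  then obtain A B where AB: "\<And>j y. ((\<lambda>\<theta>. cos (real j * \<theta>) * (g (y + \<theta>) + g (y - \<theta>))) has_integral
            A j * cos (real j * y) + B j * sin (real j * y)) {0..pi}"
    by metis
  have "((\<lambda>\<theta>. \<sigma> \<theta> * (g (y + \<theta>) + g (y - \<theta>))) has_integral
      (\<Sum>j<n. b j * (A j * cos (real j * y) + B j * sin (real j * y)))) {0..pi}" for y
  proof -
    have "((\<lambda>\<theta>. \<Sum>j<n. b j * (cos (real j * \<theta>) * (g (y + \<theta>) + g (y - \<theta>)))) has_integral
      (\<Sum>j<n. b j * (A j * cos (real j * y) + B j * sin (real j * y)))) {0..pi}"
      by (intro has_integral_sum has_integral_mult_right AB) auto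
    moreover have "(\<lambda>\<theta>. \<Sum>j<n. b j * (cos (real j * \<theta>) * (g (y + \<theta>) + g (y - \<theta>)))) =
       (\<lambda>\<theta>. \<sigma> \<theta> * (g (y + \<theta>) + g (y - \<theta>)))"
      unfolding b sum_distrib_right by (simp only: mult.assoc)
    ultimately show ?thesis by simp
  qed
  moreover have "(\<lambda>y. \<Sum>j<n. b j * (A j * cos (real j * y) + B j * sin (real j * y))) \<in> trig_polys (n - 1)"
    by (intro trig_polys_sum trig_polys_cmult trig_polys_harmonic) auto
  ultimately show ?thesis by (intro bexI allI)
qed

section \<open>Favard's inequality of second order\<close>

text \<open>Favard's inequality. Integrating \<open>\<theta>\<^sup>2 * (F'' (y + \<theta>) + F'' (y - \<theta>))\<close> by parts twice over \<open>[0, \<pi>]\<close>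
  reproduces \<open>F (y + \<pi>)\<close> up to the factor \<open>-4\<pi>\<close> and a constant. If \<open>\<theta>\<^sup>2\<close> is replaced by the interpolating cosine
  polynomial \<open>\<sigma>\<close>, the integral becomes a trigonometric polynomial in \<open>y\<close>, and the difference is controlled by the
  integral of \<open>\<bar>\<theta>\<^sup>2 - \<sigma> \<theta>\<bar>\<close>.\<close>

theorem favard_second_order:
  fixes F F' F'' :: "real \<Rightarrow> real"
  assumes dF: "\<And>x. (F has_real_derivative F' x) (at x)"
    and dF': "\<And>x. (F' has_real_derivative F'' x) (at x)"
    and cont: "continuous_on UNIV F''"
    and per: "\<And>x. F (x + 2 * pi) = F x"
    and M: "\<And>x. \<bar>F'' x\<bar> \<le> M"
    and n: "n \<ge> 1"
  shows "\<exists>\<tau>\<in>trig_polys (n - 1). \<forall>x. \<bar>F x - \<tau> x\<bar> \<le> pi\<^sup>2 / (8 * real n ^ 2) * M"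
proof -
  have per': "F' (x + 2 * pi) = F' x" for x
  proof -
    have "((\<lambda>x. F (x + 2 * pi)) has_real_derivative F' (x + 2 * pi)) (at x)"
      using dF[of "x + 2 * pi"] by (simp add: DERIV_shift)
    then show ?thesis using dF[of x] unfolding per by (rule DERIV_unique)
  qed
  have per'': "F'' (x + 2 * pi) = F'' x" for x
  proof -
    have "((\<lambda>x. F' (x + 2 * pi)) has_real_derivative F'' (x + 2 * pi)) (at x)"
      using dF'[of "x + 2 * pi"] by (simp add: DERIV_shift)
    then show ?thesis using dF'[of x] unfolding per' by (rule DERIV_unique)
  qed
  have "continuous_on UNIV F" using DERIV_isCont[OF dF] by (simp add: continuous_at_imp_continuous_on)
  then obtain G where G: "\<And>x. (G has_real_derivative F x) (at x)"
    using continuous_has_antiderivative by auto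
  obtain m where m: "\<And>y. G (y + pi) - G (y - pi) = m"
    using periodic_antiderivative_increment[OF G per] by auto
  obtain \<sigma> where \<sigma>: "\<sigma> \<in> cos_polys n"
    and L1: "((\<lambda>\<theta>. \<bar>\<theta>\<^sup>2 - \<sigma> \<theta>\<bar>) has_integral pi ^ 3 / (4 * real n ^ 2)) {0..pi}"
    using favard_kernel_L1_norm[OF n] by blast
  obtain \<rho> where \<rho>: "\<rho> \<in> trig_polys (n - 1)"
    and \<rho>_int: "\<And>y. ((\<lambda>\<theta>. \<sigma> \<theta> * (F'' (y + \<theta>) + F'' (y - \<theta>))) has_integral \<rho> y) {0..pi}"
    using cos_polys_convolution[OF cont per'' n \<sigma>] by blast
  have sq: "((\<lambda>\<theta>. \<theta>\<^sup>2 * (F'' (y + \<theta>) + F'' (y - \<theta>))) has_integral 2 * m - 4 * pi * F (y + pi)) {0..pi}" for y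
  proof -
    define Q where "Q = (\<lambda>\<theta>. \<theta>\<^sup>2 * (F' (y + \<theta>) - F' (y - \<theta>)) - 2 * \<theta> * (F (y + \<theta>) + F (y - \<theta>))
      + 2 * (G (y + \<theta>) - G (y - \<theta>)))"
    have "(Q has_real_derivative \<theta>\<^sup>2 * (F'' (y + \<theta>) + F'' (y - \<theta>))) (at \<theta>)" for \<theta>
      unfolding Q_def
      by (auto intro!: derivative_eq_intros DERIV_chain2[OF dF] DERIV_chain2[OF dF'] DERIV_chain2[OF G]
          simp: algebra_simps)
    then have "((\<lambda>\<theta>. \<theta>\<^sup>2 * (F'' (y + \<theta>) + F'' (y - \<theta>))) has_integral Q pi - Q 0) {0..pi}"
      by (intro fundamental_theorem_of_calculus)
         (auto simp: has_real_derivative_iff_has_vector_derivative[symmetric] intro: has_field_derivative_at_within)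
    moreover have "Q pi - Q 0 = 2 * m - 4 * pi * F (y + pi)"
      using per[of "y - pi"] per'[of "y - pi"] m[of y] by (simp add: Q_def algebra_simps)
    ultimately show ?thesis by simp
  qed
  have bound: "\<bar>2 * m - 4 * pi * F (y + pi) - \<rho> y\<bar> \<le> 2 * M * (pi ^ 3 / (4 * real n ^ 2))" for y
  proof -
    have 1: "((\<lambda>\<theta>. (\<theta>\<^sup>2 - \<sigma> \<theta>) * (F'' (y + \<theta>) + F'' (y - \<theta>))) has_integral
        2 * m - 4 * pi * F (y + pi) - \<rho> y) {0..pi}"
      using has_integral_diff[OF sq[of y] \<rho>_int[of y]] by (simp add: left_diff_distrib)
    have 2: "((\<lambda>\<theta>. 2 * M * \<bar>\<theta>\<^sup>2 - \<sigma> \<theta>\<bar>) has_integral 2 * M * (pi ^ 3 / (4 * real n ^ 2))) {0..pi}"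
      by (rule has_integral_mult_right[OF L1])
    have "norm ((\<theta>\<^sup>2 - \<sigma> \<theta>) * (F'' (y + \<theta>) + F'' (y - \<theta>))) \<le> 2 * M * \<bar>\<theta>\<^sup>2 - \<sigma> \<theta>\<bar>" for \<theta>
    proof -
      have "\<bar>F'' (y + \<theta>) + F'' (y - \<theta>)\<bar> \<le> 2 * M"
        using M[of "y + \<theta>"] M[of "y - \<theta>"] by linarith
      then show ?thesis
        using mult_right_mono[of _ "2 * M" "\<bar>\<theta>\<^sup>2 - \<sigma> \<theta>\<bar>"]
        by (simp add: abs_mult mult.commute[of "\<bar>\<theta>\<^sup>2 - \<sigma> \<theta>\<bar>"])
    qed
    then have "norm (integral {0..pi} (\<lambda>\<theta>. (\<theta>\<^sup>2 - \<sigma> \<theta>) * (F'' (y + \<theta>) + F'' (y - \<theta>))))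
        \<le> integral {0..pi} (\<lambda>\<theta>. 2 * M * \<bar>\<theta>\<^sup>2 - \<sigma> \<theta>\<bar>)"
      using 1 2 by (intro integral_norm_bound_integral) (auto simp: has_integral_integrable_integral)
    then show ?thesis using integral_unique[OF 1] integral_unique[OF 2] by simp
  qed
  define \<tau> where "\<tau> = (\<lambda>x. 1 / (4 * pi) * (2 * m - \<rho> (x - pi)))"
  have "\<tau> \<in> trig_polys (n - 1)"
    unfolding \<tau>_def by (intro trig_polys_cmult trig_polys_diff trig_polys_const trig_polys_shift \<rho>)
  moreover have "\<bar>F x - \<tau> x\<bar> \<le> pi\<^sup>2 / (8 * real n ^ 2) * M" for x
  proof -
    have "F x - \<tau> x = - (1 / (4 * pi)) * (2 * m - 4 * pi * F x - \<rho> (x - pi))"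
      by (simp add: \<tau>_def field_simps)
    then have "\<bar>F x - \<tau> x\<bar> = 1 / (4 * pi) * \<bar>2 * m - 4 * pi * F x - \<rho> (x - pi)\<bar>"
      by (simp add: abs_mult)
    also have "\<dots> \<le> 1 / (4 * pi) * (2 * M * (pi ^ 3 / (4 * real n ^ 2)))"
      using bound[of "x - pi"] by (intro mult_left_mono) auto
    also have "\<dots> = pi\<^sup>2 / (8 * real n ^ 2) * M"
      using n by (simp add: field_simps power3_eq_cube power2_eq_square)
    finally show ?thesis .
  qed
  ultimately show ?thesis by blast
qed

section \<open>Second differences and Steklov means\<close>

definition second_diff :: "real \<Rightarrow> (real \<Rightarrow> real) \<Rightarrow> real \<Rightarrow> real" where
  "second_diff t g x = g (x + t) - 2 * g x + g (x - t)"

lemma has_derivative_second_diff: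
  assumes "\<And>x. (g has_real_derivative g' x) (at x)"
  shows "(second_diff t g has_real_derivative second_diff t g' x) (at x)"
  unfolding second_diff_def by (auto intro!: derivative_eq_intros DERIV_chain2[OF assms])

lemma second_diff_abs_le:
  assumes "\<And>y. \<bar>g y\<bar> \<le> e"
  shows "\<bar>second_diff t g x\<bar> \<le> 4 * e"
  using assms[of "x + t"] assms[of x] assms[of "x - t"] by (simp add: second_diff_def)

text \<open>A second antiderivative \<open>P\<close> of a periodic function need not be periodic, but \<open>P (x + 2\<pi>) - P x\<close>
  is affine in \<open>x\<close>, and second differences annihilate affine functions.\<close>

lemma second_diff_periodic:
  assumes dP: "\<And>x. (P has_real_derivative P' x) (at x)"
    and dP': "\<And>x. (P' has_real_derivative f x) (at x)"
    and f: "\<And>x. f (x + 2 * pi) = f x"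
  shows "second_diff t P (x + 2 * pi) = second_diff t P x"
proof -
  have "((\<lambda>x. P' (x + 2 * pi) - P' x) has_real_derivative 0) (at x)" for x
  proof -
    have "((\<lambda>x. P' (x + 2 * pi)) has_real_derivative f x) (at x)"
      using dP'[of "x + 2 * pi"] f by (simp add: DERIV_shift)
    from DERIV_diff[OF this dP'] show ?thesis by simp
  qed
  then have c: "P' (x + 2 * pi) - P' x = P' (2 * pi) - P' 0" for x
    using has_real_derivative_zero_const[of "\<lambda>x. P' (x + 2 * pi) - P' x" x 0] by simp
  have "((\<lambda>x. P (x + 2 * pi) - P x - (P' (2 * pi) - P' 0) * x) has_real_derivative 0) (at x)" for x
  proof -
    have "((\<lambda>x. P (x + 2 * pi) - P x - (P' (2 * pi) - P' 0) * x) has_real_derivative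
        P' (x + 2 * pi) - P' x - (P' (2 * pi) - P' 0)) (at x)"
      by (rule derivative_eq_intros DERIV_chain2[OF dP] dP | simp)+
    then show ?thesis by (simp add: c)
  qed
  then have d: "P (x + 2 * pi) = P x + (P' (2 * pi) - P' 0) * x + (P (2 * pi) - P 0)" for x
    using has_real_derivative_zero_const[of "\<lambda>x. P (x + 2 * pi) - P x - (P' (2 * pi) - P' 0) * x" x 0] by simp
  show ?thesis
    using d[of "x + t"] d[of "x - t"] d[of x] by (simp add: second_diff_def algebra_simps)
qed

lemma trig_poly_second_antiderivative:
  assumes "\<tau> \<in> trig_polys m"
  obtains P P' where "\<And>x. (P has_real_derivative P' x) (at x)"
    "\<And>x. (P' has_real_derivative \<tau> x) (at x)" "\<And>t. second_diff t P \<in> trig_polys m"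
proof -
  obtain a b where \<tau>: "\<And>x. \<tau> x = (\<Sum>k\<le>m. a k * cos (real k * x) + b k * sin (real k * x))"
    using assms by (auto simp: trig_polys_def)
  define p where "p = (\<lambda>k x. if k = 0 then a k * x\<^sup>2 / 2
     else - (a k * cos (real k * x) + b k * sin (real k * x)) / real k ^ 2)"
  define p' where "p' = (\<lambda>k x. if k = 0 then a k * x
     else (a k * sin (real k * x) - b k * cos (real k * x)) / real k)"
  have 1: "(p k has_real_derivative p' k x) (at x)" for k x
    by (cases "k = 0") (auto simp: p_def p'_def power2_eq_square field_simps intro!: derivative_eq_intros)
  have 2: "(p' k has_real_derivative a k * cos (real k * x) + b k * sin (real k * x)) (at x)" for k x
    by (cases "k = 0") (auto simp: p'_def field_simps intro!: derivative_eq_intros)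
  have 3: "second_diff t (p k) \<in> trig_polys m" if "k \<le> m" for t k
  proof (cases "k = 0")
    case True
    have "second_diff t (p k) x = a k * t\<^sup>2" for x
      using True by (simp add: second_diff_def p_def power2_eq_square field_simps)
    then have "second_diff t (p k) = (\<lambda>x. a k * t\<^sup>2)" by (rule ext)
    then show ?thesis by (simp add: trig_polys_const)
  next
    case False
    have "second_diff t (p k) = (\<lambda>x. (2 - 2 * cos (real k * t)) / real k ^ 2
        * (a k * cos (real k * x) + b k * sin (real k * x)))"
    proof
      fix x
      define u where "u = (\<lambda>y. a k * cos (real k * y) + b k * sin (real k * y))"
      have p: "p k y = - u y / real k ^ 2" for y using False by (simp add: p_def u_def)
      have "u (x + t) + u (x - t) = 2 * cos (real k * t) * u x"
        by (simp add: u_def distrib_left right_diff_distrib cos_add sin_add cos_diff sin_diff)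
      then have "second_diff t (p k) x = (2 * u x - 2 * cos (real k * t) * u x) / real k ^ 2"
        by (simp add: second_diff_def p add_divide_distrib[symmetric] diff_divide_distrib[symmetric])
      then show "second_diff t (p k) x = (2 - 2 * cos (real k * t)) / real k ^ 2
        * (a k * cos (real k * x) + b k * sin (real k * x))"
        unfolding u_def by (simp add: algebra_simps)
    qed
    then show ?thesis by (simp only:) (intro trig_polys_cmult trig_polys_harmonic that)
  qed
  show thesis
  proof (rule that[of "\<lambda>x. \<Sum>k\<le>m. p k x" "\<lambda>x. \<Sum>k\<le>m. p' k x"])
    show "((\<lambda>x. \<Sum>k\<le>m. p k x) has_real_derivative (\<Sum>k\<le>m. p' k x)) (at x)" for x
      by (intro DERIV_sum 1)
    show "((\<lambda>x. \<Sum>k\<le>m. p' k x) has_real_derivative \<tau> x) (at x)" for x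
      unfolding \<tau> by (intro DERIV_sum 2)
    have "second_diff t (\<lambda>x. \<Sum>k\<le>m. p k x) = (\<lambda>x. \<Sum>k\<le>m. second_diff t (p k) x)" for t
      by (simp add: second_diff_def fun_eq_iff sum.distrib sum_subtractf sum_distrib_left)
    then show "second_diff t (\<lambda>x. \<Sum>k\<le>m. p k x) \<in> trig_polys m" for t
      by (simp only:) (intro trig_polys_sum 3, auto)
  qed
qed

text \<open>For weights \<open>w i = \<beta> i / (t i)\<^sup>2\<close> the sum of the second differences of \<open>P\<close> is a linear combination of
  Steklov means of \<open>f\<close>. Its second derivative is the same combination of second differences of \<open>f\<close>
  itself. Before Favard's inequality is applied, a combination of Steklov means of a trigonometric polynomial
  \<open>\<tau>\<close> may be subtracted; this changes the best approximation not at all but can make the second derivative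
  small.\<close>

lemma smoothed_trig_approx:
  fixes w v t :: "'i \<Rightarrow> real"
  assumes dP: "\<And>x. (P has_real_derivative P' x) (at x)"
    and dP': "\<And>x. (P' has_real_derivative f x) (at x)"
    and f: "f \<in> C_per" and n: "n \<ge> 1" and \<tau>: "\<tau> \<in> trig_polys (n - 1)" and I: "finite I"
    and B: "\<And>x. \<bar>\<Sum>i\<in>I. w i * second_diff (t i) f x - v i * second_diff (t i) \<tau> x\<bar> \<le> B"
  shows "\<exists>\<rho>\<in>trig_polys (n - 1). \<forall>x.
           \<bar>(\<Sum>i\<in>I. w i * second_diff (t i) P x) - \<rho> x\<bar> \<le> pi\<^sup>2 / (8 * real n ^ 2) * B"
proof -
  obtain S S' where dS: "\<And>x. (S has_real_derivative S' x) (at x)"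
    and dS': "\<And>x. (S' has_real_derivative \<tau> x) (at x)"
    and S: "\<And>t. second_diff t S \<in> trig_polys (n - 1)"
    using trig_poly_second_antiderivative[OF \<tau>] by blast
  have per_f: "f (x + 2 * pi) = f x" and cont_f: "continuous_on UNIV f" for x using f by (auto simp: C_per_def)
  have cos_per: "cos (real k * (x + 2 * pi)) = cos (real k * x)" "sin (real k * (x + 2 * pi)) = sin (real k * x)" for k x
    using cos_2npi[of k] sin_2npi[of k] by (simp_all add: distrib_left cos_add sin_add mult_ac)
  obtain a b where ab: "\<And>x. \<tau> x = (\<Sum>k\<le>n-1. a k * cos (real k * x) + b k * sin (real k * x))"
    using \<tau> by (auto simp: trig_polys_def)
  have per_\<tau>: "\<tau> (x + 2 * pi) = \<tau> x" for x by (simp only: ab cos_per)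
  have cont_\<tau>: "continuous_on UNIV \<tau>"
    unfolding ab[abs_def] by (intro continuous_intros)
  define T where "T = (\<lambda>g h x. \<Sum>i\<in>I. w i * second_diff (t i) g x - v i * second_diff (t i) h x)"
  have dT: "(T g h has_real_derivative T g' h' x) (at x)"
    if "\<And>x. (g has_real_derivative g' x) (at x)" "\<And>x. (h has_real_derivative h' x) (at x)" for g h g' h' x
    unfolding T_def
    by (intro DERIV_sum DERIV_diff DERIV_cmult has_derivative_second_diff that)
  have "\<exists>\<rho>\<in>trig_polys (n - 1). \<forall>x. \<bar>T P S x - \<rho> x\<bar> \<le> pi\<^sup>2 / (8 * real n ^ 2) * B"
  proof (rule favard_second_order[OF dT[OF dP dS] dT[OF dP' dS'] _ _ _ n])
    show "continuous_on UNIV (T f \<tau>)"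
      unfolding T_def second_diff_def
      by (intro continuous_intros continuous_on_compose2[OF cont_f] continuous_on_compose2[OF cont_\<tau>]) auto
    show "T P S (x + 2 * pi) = T P S x" for x
      unfolding T_def using second_diff_periodic[OF dP dP' per_f] second_diff_periodic[OF dS dS' per_\<tau>] by simp
    show "\<bar>T f \<tau> x\<bar> \<le> B" for x using B by (simp add: T_def)
  qed
  then obtain \<rho> where \<rho>: "\<rho> \<in> trig_polys (n - 1)" and le: "\<And>x. \<bar>T P S x - \<rho> x\<bar> \<le> pi\<^sup>2 / (8 * real n ^ 2) * B"
    by blast
  have "(\<lambda>x. \<rho> x + (\<Sum>i\<in>I. v i * second_diff (t i) S x)) \<in> trig_polys (n - 1)"
    by (intro trig_polys_add trig_polys_sum trig_polys_cmult \<rho> I S)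
  moreover have "(\<Sum>i\<in>I. w i * second_diff (t i) P x) - (\<rho> x + (\<Sum>i\<in>I. v i * second_diff (t i) S x)) = T P S x - \<rho> x" for x
    by (simp add: T_def sum_subtractf)
  ultimately show ?thesis using le by (intro bexI[rotated]) (assumption, simp only:, blast)
qed

text \<open>The second order Taylor estimate, in the one-sided form in which it follows from monotonicity.\<close>

lemma taylor_nonneg:
  fixes R R' R'' :: "real \<Rightarrow> real"
  assumes dR: "\<And>s. (R has_real_derivative R' s) (at s)" and dR': "\<And>s. (R' has_real_derivative R'' s) (at s)"
    and "R 0 = 0" "R' 0 = 0" and R'': "\<And>s. 0 \<le> s \<Longrightarrow> s \<le> h \<Longrightarrow> R'' s \<ge> 0" and "0 \<le> h"
  shows "R h \<ge> 0"
proof -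
  have "R' s \<ge> 0" if "0 \<le> s" "s \<le> h" for s
    using DERIV_nonneg_imp_nondecreasing[of 0 s R'] dR' R'' assms that by (metis order_trans)
  then show ?thesis
    using DERIV_nonneg_imp_nondecreasing[of 0 h R] dR assms by metis
qed

text \<open>The distance of \<open>f x\<close> from the combination of Steklov means with weights \<open>2 * \<alpha> i\<close> is an average of
  the symmetric differences in the hypothesis. To see this without computing the averages, multiply by the
  square of the step \<open>s\<close>: the resulting function \<open>Q\<close> of \<open>s\<close> vanishes to second order at \<open>0\<close>, and its second derivative is twice
  the symmetric difference with step \<open>s\<close>.\<close>

lemma steklov_error:
  fixes \<alpha> :: "nat \<Rightarrow> real"
  assumes dP: "\<And>x. (P has_real_derivative P' x) (at x)"
    and dP': "\<And>x. (P' has_real_derivative f x) (at x)"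
    and \<alpha>: "(\<Sum>i=1..k. \<alpha> i) = 1 / 2" and h: "h > 0"
    and C: "\<And>s. 0 < s \<Longrightarrow> s \<le> h \<Longrightarrow> \<bar>f x - (\<Sum>i=1..k. \<alpha> i * (f (x + real i * s) + f (x - real i * s)))\<bar> \<le> C"
  shows "\<bar>f x - (\<Sum>i=1..k. 2 * \<alpha> i / (real i * h)\<^sup>2 * second_diff (real i * h) P x)\<bar> \<le> C"
proof -
  define Q where "Q = (\<lambda>s. s\<^sup>2 * f x - (\<Sum>i=1..k. 2 * \<alpha> i / (real i)\<^sup>2 * second_diff (real i * s) P x))"
  define Q' where "Q' = (\<lambda>s. 2 * s * f x - (\<Sum>i=1..k. 2 * \<alpha> i / real i * (P' (x + real i * s) - P' (x - real i * s))))"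
  define Q'' where "Q'' = (\<lambda>s. 2 * f x - (\<Sum>i=1..k. 2 * \<alpha> i * (f (x + real i * s) + f (x - real i * s))))"
  have dQ: "(Q has_real_derivative Q' s) (at s)" for s
    unfolding Q_def Q'_def second_diff_def
  proof (intro DERIV_diff DERIV_sum)
    fix i assume "i \<in> {1..k}"
    then show "((\<lambda>s. 2 * \<alpha> i / (real i)\<^sup>2 * (P (x + real i * s) - 2 * P x + P (x - real i * s))) has_real_derivative
        2 * \<alpha> i / real i * (P' (x + real i * s) - P' (x - real i * s))) (at s)"
      by (auto intro!: derivative_eq_intros DERIV_chain2[OF dP] simp: field_simps power2_eq_square)
  qed (auto intro!: derivative_eq_intros)
  have dQ': "(Q' has_real_derivative Q'' s) (at s)" for s
    unfolding Q''_def Q'_def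
  proof (intro DERIV_diff DERIV_sum)
    fix i assume "i \<in> {1..k}"
    then show "((\<lambda>s. 2 * \<alpha> i / real i * (P' (x + real i * s) - P' (x - real i * s))) has_real_derivative
        2 * \<alpha> i * (f (x + real i * s) + f (x - real i * s))) (at s)"
      by (auto intro!: derivative_eq_intros DERIV_chain2[OF dP'] simp: field_simps)
  qed (auto intro!: derivative_eq_intros)
  have Q0: "Q 0 = 0" "Q' 0 = 0" by (simp_all add: Q_def Q'_def second_diff_def)
  have C0: "C \<ge> 0" using C[of h] h by linarith
  have Q'': "\<bar>Q'' s\<bar> \<le> 2 * C" if "0 \<le> s" "s \<le> h" for s
  proof -
    have e: "Q'' s = 2 * (f x - (\<Sum>i=1..k. \<alpha> i * (f (x + real i * s) + f (x - real i * s))))"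
      by (simp add: Q''_def right_diff_distrib sum_distrib_left mult.assoc)
    show ?thesis
    proof (cases "s = 0")
      case True
      have "Q'' s = 2 * (f x - (\<Sum>i=1..k. \<alpha> i) * (2 * f x))"
        using e by (simp add: True sum_distrib_right)
      then have "Q'' s = 0" unfolding \<alpha> by simp
      then show ?thesis using C0 by simp
    next
      case False
      then show ?thesis using C[of s] that by (simp add: e abs_mult)
    qed
  qed
  \<comment> \<open>\<open>\<bar>Q h\<bar> \<le> C * h\<^sup>2\<close> by the Taylor estimate for \<open>C * s\<^sup>2 - Q s\<close> and \<open>C * s\<^sup>2 + Q s\<close>.\<close>
  have "C * h\<^sup>2 - Q h \<ge> 0"
    by (rule taylor_nonneg[where R = "\<lambda>s. C * s\<^sup>2 - Q s" and R' = "\<lambda>s. C * (2 * s) - Q' s" and R'' = "\<lambda>s. 2 * C - Q'' s"])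
       (use dQ dQ' Q0 Q'' h in \<open>force simp: abs_le_iff intro!: derivative_eq_intros\<close>)+
  moreover have "C * h\<^sup>2 + Q h \<ge> 0"
    by (rule taylor_nonneg[where R = "\<lambda>s. C * s\<^sup>2 + Q s" and R' = "\<lambda>s. C * (2 * s) + Q' s" and R'' = "\<lambda>s. 2 * C + Q'' s"])
       (use dQ dQ' Q0 Q'' h in \<open>force simp: abs_le_iff intro!: derivative_eq_intros\<close>)+
  ultimately have "\<bar>Q h\<bar> \<le> C * h\<^sup>2" by linarith
  moreover have "Q h = h\<^sup>2 * (f x - (\<Sum>i=1..k. 2 * \<alpha> i / (real i * h)\<^sup>2 * second_diff (real i * h) P x))"
    using h by (simp add: Q_def right_diff_distrib sum_distrib_left power_mult_distrib)
  ultimately have "h\<^sup>2 * \<bar>f x - (\<Sum>i=1..k. 2 * \<alpha> i / (real i * h)\<^sup>2 * second_diff (real i * h) P x)\<bar> \<le> h\<^sup>2 * C"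
    by (simp add: abs_mult mult.commute)
  then show ?thesis using h by simp
qed

section \<open>Best approximation and the modulus of smoothness\<close>

lemma C_per_bounded:
  assumes "f \<in> C_per"
  shows "\<exists>B. \<forall>x. \<bar>f x\<bar> \<le> B"
proof -
  have cont: "continuous_on UNIV f" and per: "\<And>x. f (x + 2 * pi) = f x"
    using assms by (auto simp: C_per_def)
  have "compact (f ` {0..2 * pi})"
    by (intro compact_continuous_image continuous_on_subset[OF cont]) auto
  then have "\<exists>B. \<forall>y\<in>f ` {0..2 * pi}. norm y \<le> B"
    using compact_imp_bounded bounded_iff by blast
  then obtain B where "\<forall>y\<in>f ` {0..2 * pi}. norm y \<le> B" ..
  then have B: "\<bar>f y\<bar> \<le> B" if "y \<in> {0..2 * pi}" for y using that by simp
  have nat: "f (x + real k * (2 * pi)) = f x" for k x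
  proof (induction k)
    case (Suc k)
    then show ?case using per[of "x + real k * (2 * pi)"] by (simp add: algebra_simps)
  qed simp
  \<comment> \<open>A negative multiple of the period is undone by the positive one.\<close>
  have int: "f (x + of_int i * (2 * pi)) = f x" for i x
  proof (cases "i \<ge> 0")
    case True
    then show ?thesis using nat[of x "nat i"] by simp
  next
    case False
    then show ?thesis using nat[of "x + of_int i * (2 * pi)" "nat (- i)"] by simp
  qed
  have "\<bar>f x\<bar> \<le> B" for x
  proof -
    define y where "y = x / (2 * pi)"
    have "of_int \<lfloor>y\<rfloor> * (2 * pi) \<le> y * (2 * pi)" by (intro mult_right_mono) auto
    moreover have "y * (2 * pi) < (of_int \<lfloor>y\<rfloor> + 1) * (2 * pi)"
      by (intro mult_strict_right_mono) auto
    moreover have "x = y * (2 * pi)" by (simp add: y_def)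
    ultimately have "x + of_int (- \<lfloor>y\<rfloor>) * (2 * pi) \<in> {0..2 * pi}"
      by (auto simp: algebra_simps)
    from B[OF this] show ?thesis unfolding int .
  qed
  then show ?thesis by blast
qed

lemma trig_poly_bounded:
  assumes "\<tau> \<in> trig_polys m"
  shows "\<exists>B. \<forall>x. \<bar>\<tau> x\<bar> \<le> B"
proof -
  obtain a b where ab: "\<And>x. \<tau> x = (\<Sum>k\<le>m. a k * cos (real k * x) + b k * sin (real k * x))"
    using assms by (auto simp: trig_polys_def)
  have "\<bar>\<tau> x\<bar> \<le> (\<Sum>k\<le>m. \<bar>a k\<bar> + \<bar>b k\<bar>)" for x
    unfolding ab
  proof (rule order_trans[OF sum_abs sum_mono])
    fix k
    have "\<bar>a k * cos (real k * x)\<bar> \<le> \<bar>a k\<bar>" "\<bar>b k * sin (real k * x)\<bar> \<le> \<bar>b k\<bar>"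
      by (simp_all add: abs_mult mult_left_le)
    then show "\<bar>a k * cos (real k * x) + b k * sin (real k * x)\<bar> \<le> \<bar>a k\<bar> + \<bar>b k\<bar>"
      by linarith
  qed
  then show ?thesis by blast
qed

lemma abs_le_sup_norm:
  assumes "\<And>x. \<bar>g x\<bar> \<le> B"
  shows "\<bar>g x\<bar> \<le> sup_norm g"
  unfolding sup_norm_def by (rule cSUP_upper) (auto intro!: bdd_aboveI2 assms)

lemma sup_norm_le:
  assumes "\<And>x. \<bar>g x\<bar> \<le> B"
  shows "sup_norm g \<le> B"
  unfolding sup_norm_def by (rule cSUP_least) (auto intro: assms)

lemma error_abs_le_sup_norm:
  assumes "f \<in> C_per" "\<tau> \<in> trig_polys m"
  shows "\<bar>f x - \<tau> x\<bar> \<le> sup_norm (\<lambda>x. f x - \<tau> x)"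
proof -
  obtain A B where AB: "\<And>x. \<bar>f x\<bar> \<le> A" "\<And>x. \<bar>\<tau> x\<bar> \<le> B"
    using C_per_bounded[OF assms(1)] trig_poly_bounded[OF assms(2)] by auto
  have "\<bar>f x - \<tau> x\<bar> \<le> A + B" for x using AB[of x] by linarith
  then show ?thesis by (rule abs_le_sup_norm)
qed

lemma best_approx_le:
  assumes f: "f \<in> C_per" and \<tau>: "\<tau> \<in> trig_polys m" and B: "\<And>x. \<bar>f x - \<tau> x\<bar> \<le> B"
  shows "best_approx m f \<le> B"
proof -
  have "best_approx m f \<le> sup_norm (\<lambda>x. f x - \<tau> x)"
    unfolding best_approx_def
  proof (rule cINF_lower[OF _ \<tau>])
    show "bdd_below ((\<lambda>\<tau>. sup_norm (\<lambda>x. f x - \<tau> x)) ` trig_polys m)"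
    proof (rule bdd_belowI2[where m = 0])
      fix \<rho> assume "\<rho> \<in> trig_polys m"
      from error_abs_le_sup_norm[OF f this, of 0] show "0 \<le> sup_norm (\<lambda>x. f x - \<rho> x)" by linarith
    qed
  qed
  also have "\<dots> \<le> B" by (rule sup_norm_le[OF B])
  finally show ?thesis .
qed

lemma near_best_approx:
  assumes f: "f \<in> C_per" and \<epsilon>: "\<epsilon> > 0"
  shows "\<exists>\<tau>\<in>trig_polys m. \<forall>x. \<bar>f x - \<tau> x\<bar> \<le> best_approx m f + \<epsilon>"
proof -
  have ne: "trig_polys m \<noteq> {}" using trig_polys_const[of 0 m] by blast
  have "\<exists>\<tau>\<in>trig_polys m. sup_norm (\<lambda>x. f x - \<tau> x) < best_approx m f + \<epsilon>"
  proof (rule ccontr)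
    assume "\<not> ?thesis"
    then have "best_approx m f + \<epsilon> \<le> best_approx m f"
      unfolding best_approx_def[of m f] by (intro cINF_greatest ne) (auto simp: not_less best_approx_def)
    with \<epsilon> show False by simp
  qed
  then obtain \<tau> where \<tau>: "\<tau> \<in> trig_polys m" and lt: "sup_norm (\<lambda>x. f x - \<tau> x) < best_approx m f + \<epsilon>"
    by auto
  have "\<bar>f x - \<tau> x\<bar> \<le> best_approx m f + \<epsilon>" for x
    using error_abs_le_sup_norm[OF f \<tau>, of x] lt by linarith
  with \<tau> show ?thesis by auto
qed

lemma diff_op_le_modulus:
  assumes f: "f \<in> C_per" and h: "0 < h" "h \<le> \<delta>"
  shows "\<bar>diff_op r h f x\<bar> \<le> modulus_smoothness r f \<delta>"
proof -
  obtain B where B: "\<And>x. \<bar>f x\<bar> \<le> B" using C_per_bounded[OF f] by auto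
  have bd: "\<bar>diff_op r t f y\<bar> \<le> (\<Sum>i=0..r. real (r choose i) * B)" for t y
    unfolding diff_op_def
    by (rule order_trans[OF sum_abs sum_mono]) (simp add: abs_mult mult_left_mono B)
  have "\<bar>diff_op r h f x\<bar> \<le> sup_norm (diff_op r h f)" by (rule abs_le_sup_norm[OF bd])
  also have "\<dots> \<le> modulus_smoothness r f \<delta>"
    unfolding modulus_smoothness_def
  proof (rule cSUP_upper)
    show "bdd_above ((\<lambda>h. sup_norm (diff_op r h f)) ` {0<..\<delta>})"
      by (rule bdd_aboveI2, rule sup_norm_le[OF bd])
  qed (use h in auto)
  finally show ?thesis .
qed

lemma diff_op_Suc: "diff_op (Suc r) h f x = diff_op r h f x - diff_op r h f (x + h)"
proof -
  let ?t = "\<lambda>i. (-1) ^ i * real (r choose i) * f (x + real i * h)"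
  have "diff_op (Suc r) h f x = f x + (\<Sum>i=0..r. (-1) ^ Suc i * real (Suc r choose Suc i) * f (x + real (Suc i) * h))"
    unfolding diff_op_def by (subst sum.atLeast0_atMost_Suc_shift) simp
  also have "\<dots> = f x + (\<Sum>i=0..r. ?t (Suc i)) - diff_op r h f (x + h)"
    unfolding diff_op_def add_diff_eq[symmetric] sum_subtractf[symmetric]
    by (intro arg_cong2[of _ _ _ _ "(+)"] sum.cong refl) (simp add: algebra_simps)
  also have "f x + (\<Sum>i=0..r. ?t (Suc i)) = (\<Sum>i=0..Suc r. ?t i)"
    by (subst sum.atLeast0_atMost_Suc_shift) simp
  also have "\<dots> = diff_op r h f x" by (simp add: diff_op_def)
  finally show ?thesis .
qed

lemma modulus_Suc_le:
  assumes f: "f \<in> C_per" and \<delta>: "\<delta> > 0"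
  shows "modulus_smoothness (Suc r) f \<delta> \<le> 2 * modulus_smoothness r f \<delta>"
  unfolding modulus_smoothness_def[of "Suc r"]
proof (rule cSUP_least)
  fix h assume h: "h \<in> {0<..\<delta>}"
  show "sup_norm (diff_op (Suc r) h f) \<le> 2 * modulus_smoothness r f \<delta>"
  proof (rule sup_norm_le)
    show "\<bar>diff_op (Suc r) h f x\<bar> \<le> 2 * modulus_smoothness r f \<delta>" for x
      unfolding diff_op_Suc
      using diff_op_le_modulus[OF f, of h \<delta> r x] diff_op_le_modulus[OF f, of h \<delta> r "x + h"] h by simp
  qed
qed (use \<delta> in auto)

section \<open>Jackson-Stechkin inequalities of even order\<close>

text \<open>This combines the two error terms: that of the smoothing, bounded by \<open>C\<close>, and that of
  approximating the smoothed function, bounded by Favard's inequality. In hypothesis \<open>D\<close> the polynomial \<open>\<tau>\<close> is a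
  nearly best approximation of \<open>f\<close> and \<open>e\<close> its error, so that the best approximation \<open>E\<close> reappears on the right-hand side
  with a factor \<open>pi\<^sup>2 * b / (8 * n\<^sup>2 * h\<^sup>2)\<close>. If this factor is less than \<open>1\<close>, the inequality can be solved for
  \<open>E\<close>.\<close>

lemma best_approx_steklov:
  fixes \<alpha> v :: "nat \<Rightarrow> real"
  assumes f: "f \<in> C_per" and n: "n \<ge> 1" and h: "h > 0" and \<alpha>: "(\<Sum>i=1..k. \<alpha> i) = 1 / 2"
    and C: "\<And>x s. 0 < s \<Longrightarrow> s \<le> h \<Longrightarrow> \<bar>f x - (\<Sum>i=1..k. \<alpha> i * (f (x + real i * s) + f (x - real i * s)))\<bar> \<le> C"
    and D: "\<And>\<tau> e x. \<tau> \<in> trig_polys (n - 1) \<Longrightarrow> (\<And>y. \<bar>f y - \<tau> y\<bar> \<le> e) \<Longrightarrow>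
       \<bar>\<Sum>i=1..k. 2 * \<alpha> i / (real i)\<^sup>2 * second_diff (real i * h) f x - v i * second_diff (real i * h) \<tau> x\<bar> \<le> a + b * e"
  shows "best_approx (n - 1) f \<le> C + pi\<^sup>2 / (8 * real n ^ 2 * h\<^sup>2) * (a + b * best_approx (n - 1) f)"
proof -
  define E where "E = best_approx (n - 1) f"
  define \<kappa> where "\<kappa> = pi\<^sup>2 / (8 * real n ^ 2 * h\<^sup>2)"
  have cont: "continuous_on UNIV f" using f by (simp add: C_per_def)
  obtain P' where dP': "\<And>x. (P' has_real_derivative f x) (at x)"
    using continuous_has_antiderivative[OF cont] by auto
  have "continuous_on UNIV P'" using DERIV_isCont[OF dP'] by (simp add: continuous_at_imp_continuous_on)
  then obtain P where dP: "\<And>x. (P has_real_derivative P' x) (at x)"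
    using continuous_has_antiderivative by auto
  \<comment> \<open>A best approximation is replaced by one with error at most \<open>E + \<epsilon>\<close>; finally \<open>\<epsilon>\<close> tends to \<open>0\<close>.\<close>
  have step: "E \<le> C + \<kappa> * (a + b * (E + \<epsilon>))" if \<epsilon>: "\<epsilon> > 0" for \<epsilon>
  proof -
    obtain \<tau> where \<tau>: "\<tau> \<in> trig_polys (n - 1)" and e: "\<And>y. \<bar>f y - \<tau> y\<bar> \<le> E + \<epsilon>"
      using near_best_approx[OF f \<epsilon>, of "n - 1"] by (auto simp: E_def)
    have "\<bar>\<Sum>i=1..k. 2 * \<alpha> i / (real i * h)\<^sup>2 * second_diff (real i * h) f x
        - v i / h\<^sup>2 * second_diff (real i * h) \<tau> x\<bar> \<le> (a + b * (E + \<epsilon>)) / h\<^sup>2" for x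
    proof -
      have "(\<Sum>i=1..k. 2 * \<alpha> i / (real i * h)\<^sup>2 * second_diff (real i * h) f x
          - v i / h\<^sup>2 * second_diff (real i * h) \<tau> x)
        = (\<Sum>i=1..k. 2 * \<alpha> i / (real i)\<^sup>2 * second_diff (real i * h) f x - v i * second_diff (real i * h) \<tau> x) / h\<^sup>2"
        unfolding sum_divide_distrib
        by (intro sum.cong refl) (simp add: diff_divide_distrib power_mult_distrib)
      then show ?thesis using D[OF \<tau> e, of x] h by (simp add: divide_right_mono)
    qed
    from smoothed_trig_approx[OF dP dP' f n \<tau> finite_atLeastAtMost this]
    obtain \<rho> where \<rho>: "\<rho> \<in> trig_polys (n - 1)"
      and le: "\<And>x. \<bar>(\<Sum>i=1..k. 2 * \<alpha> i / (real i * h)\<^sup>2 * second_diff (real i * h) P x) - \<rho> x\<bar>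
          \<le> pi\<^sup>2 / (8 * real n ^ 2) * ((a + b * (E + \<epsilon>)) / h\<^sup>2)"
      by auto
    have "\<bar>f x - \<rho> x\<bar> \<le> C + \<kappa> * (a + b * (E + \<epsilon>))" for x
    proof -
      have "pi\<^sup>2 / (8 * real n ^ 2) * ((a + b * (E + \<epsilon>)) / h\<^sup>2) = \<kappa> * (a + b * (E + \<epsilon>))"
        by (simp add: \<kappa>_def)
      then show ?thesis using le[of x] steklov_error[OF dP dP' \<alpha> h C, of x] by linarith
    qed
    from best_approx_le[OF f \<rho> this] show ?thesis by (simp add: E_def)
  qed
  have "((\<lambda>\<epsilon>. C + \<kappa> * (a + b * (E + \<epsilon>))) \<longlongrightarrow> C + \<kappa> * (a + b * (E + 0))) (at_right 0)"
    by (intro tendsto_intros)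
  moreover have "\<forall>\<^sub>F \<epsilon> in at_right 0. E \<le> C + \<kappa> * (a + b * (E + \<epsilon>))"
    using step by (auto simp: eventually_at_right_field intro!: exI[of _ 1])
  ultimately have "E \<le> C + \<kappa> * (a + b * (E + 0))"
    by (intro tendsto_lowerbound) auto
  then show ?thesis by (simp add: E_def \<kappa>_def)
qed

text \<open>Here the second derivative of the Steklov mean of \<open>f\<close> is itself a multiple of a second difference of \<open>f\<close>, and
  no polynomial has to be subtracted.\<close>

lemma best_approx_le_modulus_2:
  assumes f: "f \<in> C_per" and n: "n \<ge> 1" and h: "h > 0"
  shows "best_approx (n - 1) f \<le> (1 / 2 + pi\<^sup>2 / (8 * real n ^ 2 * h\<^sup>2)) * modulus_smoothness 2 f h"
proof -
  have d: "\<bar>second_diff s f x\<bar> \<le> modulus_smoothness 2 f h" if "0 < s" "s \<le> h" for s x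
    using diff_op_le_modulus[OF f that, of 2 "x - s"]
    by (simp add: diff_op_def second_diff_def numeral_2_eq_2 algebra_simps)
  have "best_approx (n - 1) f \<le> modulus_smoothness 2 f h / 2
      + pi\<^sup>2 / (8 * real n ^ 2 * h\<^sup>2) * (modulus_smoothness 2 f h + 0 * best_approx (n - 1) f)"
  proof (rule best_approx_steklov[OF f n h, where k = 1 and \<alpha> = "\<lambda>_. 1 / 2" and v = "\<lambda>_. 0"])
    fix x s :: real assume "0 < s" "s \<le> h"
    moreover have "f x - (\<Sum>i=1..1. 1 / 2 * (f (x + real i * s) + f (x - real i * s)))
        = - (second_diff s f x / 2)"
      by (simp add: second_diff_def field_simps)
    ultimately show "\<bar>f x - (\<Sum>i=1..1. 1 / 2 * (f (x + real i * s) + f (x - real i * s)))\<bar>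
        \<le> modulus_smoothness 2 f h / 2"
      using d[of s x] by simp
  qed (use d[of h] h in auto)
  then show ?thesis by (simp add: algebra_simps)
qed

text \<open>The operator is \<open>4/3 * S h - 1/3 * S (2h)\<close> with \<open>S t\<close> the Steklov mean. Write \<open>D t\<close> for the second
  difference with step \<open>t\<close>. Up to the factor \<open>1/h\<^sup>2\<close> the second derivative of the smoothed function is \<open>4/3 * D h - 1/12 * D (2h)\<close>
  applied to \<open>f\<close>. Estimating this by \<open>f - \<tau>\<close> alone loses too much for the constant \<open>10/9\<close>. Since
  \<open>D (2h) = 4 * D h + D h * D h\<close>, it equals \<open>1/4 * D (2h) - 1/3 * D h * D h\<close>: the fourth difference
  \<open>D h * D h\<close> is bounded by the modulus of \<open>f\<close>, and only the first summand, whose norm is \<open>1\<close>, has to be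
  estimated by \<open>f - \<tau>\<close>. The weights \<open>?v\<close> subtract the polynomial in exactly that summand.\<close>

lemma best_approx_le_modulus_4:
  assumes f: "f \<in> C_per" and n: "n \<ge> 1" and h: "h > 0"
  shows "best_approx (n - 1) f \<le> modulus_smoothness 4 f h / 6
    + pi\<^sup>2 / (8 * real n ^ 2 * h\<^sup>2) * (modulus_smoothness 4 f h / 3 + 1 * best_approx (n - 1) f)"
proof -
  let ?\<alpha> = "\<lambda>i::nat. if i = 1 then 2 / 3 else - 1 / 6 :: real"
  let ?v = "\<lambda>i::nat. if i = 1 then 0 else 1 / 4 :: real"
  have d: "\<bar>6 * f x - 4 * (f (x + s) + f (x - s)) + (f (x + 2 * s) + f (x - 2 * s))\<bar> \<le> modulus_smoothness 4 f h"
    if "0 < s" "s \<le> h" for s x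
    using diff_op_le_modulus[OF f that, of 4 "x - 2 * s"]
    by (simp add: diff_op_def numeral_eq_Suc algebra_simps)
  show ?thesis
  proof (rule best_approx_steklov[OF f n h, where k = 2 and \<alpha> = ?\<alpha> and v = ?v])
    show "(\<Sum>i=1..2. ?\<alpha> i) = 1 / 2" by (simp add: numeral_2_eq_2)
  next
    fix x s :: real assume s: "0 < s" "s \<le> h"
    have eq: "f x - (\<Sum>i=1..2. ?\<alpha> i * (f (x + real i * s) + f (x - real i * s)))
        = (6 * f x - 4 * (f (x + s) + f (x - s)) + (f (x + 2 * s) + f (x - 2 * s))) / 6"
      by (simp add: numeral_2_eq_2 field_simps)
    show "\<bar>f x - (\<Sum>i=1..2. ?\<alpha> i * (f (x + real i * s) + f (x - real i * s)))\<bar> \<le> modulus_smoothness 4 f h / 6"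
      unfolding eq using d[OF s, of x] by simp
  next
    fix \<tau> e x assume e: "\<And>y. \<bar>f y - \<tau> y\<bar> \<le> e"
    have eq: "(\<Sum>i=1..2. 2 * ?\<alpha> i / (real i)\<^sup>2 * second_diff (real i * h) f x - ?v i * second_diff (real i * h) \<tau> x)
       = 1 / 4 * second_diff (2 * h) (\<lambda>y. f y - \<tau> y) x
         - 1 / 3 * (6 * f x - 4 * (f (x + h) + f (x - h)) + (f (x + 2 * h) + f (x - 2 * h)))"
      by (simp add: numeral_2_eq_2 second_diff_def field_simps)
    show "\<bar>\<Sum>i=1..2. 2 * ?\<alpha> i / (real i)\<^sup>2 * second_diff (real i * h) f x - ?v i * second_diff (real i * h) \<tau> x\<bar>
        \<le> modulus_smoothness 4 f h / 3 + 1 * e"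
    proof -
      have "\<bar>1 / 4 * A - 1 / 3 * B\<bar> \<le> W / 3 + 1 * e" if "\<bar>A\<bar> \<le> 4 * e" "\<bar>B\<bar> \<le> W" for A B W
        using that by linarith
      then show ?thesis
        unfolding eq
        using second_diff_abs_le[where g = "\<lambda>y. f y - \<tau> y" and t = "2 * h" and x = x, OF e]
          d[OF h order_refl, of x] by blast
    qed
  qed
qed

text \<open>The constant \<open>3/2\<close> leaves enough room to subtract \<open>\<tau>\<close> throughout and to bound each second
  difference of \<open>f - \<tau>\<close> by four times the error; \<open>299/45\<close> is \<open>4 * (3/2 + 3/20 + 1/90)\<close>.\<close>

lemma best_approx_le_modulus_6:
  assumes f: "f \<in> C_per" and n: "n \<ge> 1" and h: "h > 0"
  shows "best_approx (n - 1) f \<le> modulus_smoothness 6 f h / 20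
    + pi\<^sup>2 / (8 * real n ^ 2 * h\<^sup>2) * (0 + 299 / 45 * best_approx (n - 1) f)"
proof -
  let ?\<alpha> = "\<lambda>i::nat. if i = 1 then 3 / 4 else if i = 2 then - 3 / 10 else 1 / 20 :: real"
  let ?v = "\<lambda>i::nat. 2 * ?\<alpha> i / (real i)\<^sup>2"
  show ?thesis
  proof (rule best_approx_steklov[OF f n h, where k = 3 and \<alpha> = ?\<alpha> and v = ?v])
    show "(\<Sum>i=1..3. ?\<alpha> i) = 1 / 2" by (simp add: numeral_3_eq_3)
  next
    fix x s :: real assume s: "0 < s" "s \<le> h"
    have "f x - (\<Sum>i=1..3. ?\<alpha> i * (f (x + real i * s) + f (x - real i * s)))
        = - (1 / 20) * diff_op 6 s f (x - 3 * s)"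
      by (simp add: diff_op_def numeral_eq_Suc field_simps)
    then show "\<bar>f x - (\<Sum>i=1..3. ?\<alpha> i * (f (x + real i * s) + f (x - real i * s)))\<bar> \<le> modulus_smoothness 6 f h / 20"
      using diff_op_le_modulus[OF f s, of 6 "x - 3 * s"] by (simp add: abs_mult)
  next
    fix \<tau> e x assume e: "\<And>y. \<bar>f y - \<tau> y\<bar> \<le> e"
    have eq: "(\<Sum>i=1..3. 2 * ?\<alpha> i / (real i)\<^sup>2 * second_diff (real i * h) f x - ?v i * second_diff (real i * h) \<tau> x)
       = 3 / 2 * second_diff h (\<lambda>y. f y - \<tau> y) x - 3 / 20 * second_diff (2 * h) (\<lambda>y. f y - \<tau> y) x
         + 1 / 90 * second_diff (3 * h) (\<lambda>y. f y - \<tau> y) x"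
      by (simp add: numeral_3_eq_3 second_diff_def field_simps)
    show "\<bar>\<Sum>i=1..3. 2 * ?\<alpha> i / (real i)\<^sup>2 * second_diff (real i * h) f x - ?v i * second_diff (real i * h) \<tau> x\<bar>
        \<le> 0 + 299 / 45 * e"
      unfolding eq using second_diff_abs_le[where g = "\<lambda>y. f y - \<tau> y" and t = h and x = x, OF e] second_diff_abs_le[where g = "\<lambda>y. f y - \<tau> y" and t = "2 * h" and x = x, OF e]
        second_diff_abs_le[where g = "\<lambda>y. f y - \<tau> y" and t = "3 * h" and x = x, OF e] by linarith
  qed
qed

section \<open>The inequalities with explicit constants\<close>

lemma gamma_star_values:
  "gamma_star 1 = 1" "gamma_star 2 = 1 / 2" "gamma_star 3 = 1 / 3"
  "gamma_star 4 = 1 / 6" "gamma_star 5 = 1 / 10" "gamma_star 6 = 1 / 20"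
  by (simp_all add: gamma_star_def) (simp_all add: numeral_eq_Suc)

theorem theorem4:
  fixes f :: "real \<Rightarrow> real" and n :: nat
  assumes "f \<in> C_per" and "n \<ge> 1"
  shows "(\<forall>r\<in>{1..4}. best_approx (n - 1) f
            \<le> c_pi r * gamma_star r * modulus_smoothness r f (pi / real n)) \<and>
         (\<forall>r\<in>{1..6}. best_approx (n - 1) f
            \<le> c_2pi r * gamma_star r * modulus_smoothness r f (2 * pi / real n))"
proof -
  let ?E = "best_approx (n - 1) f"
  let ?a = "\<lambda>r. modulus_smoothness r f (pi / real n)"
  let ?b = "\<lambda>r. modulus_smoothness r f (2 * pi / real n)"
  have pos: "pi / real n > 0" "2 * pi / real n > 0" using assms(2) by auto
  have \<kappa>: "pi\<^sup>2 / (8 * real n ^ 2 * (pi / real n)\<^sup>2) = 1 / 8" "pi\<^sup>2 / (8 * real n ^ 2 * (2 * pi / real n)\<^sup>2) = 1 / 32"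
    using assms(2) by (simp_all add: field_simps)
  have nonneg: "0 \<le> modulus_smoothness r f \<delta>" if "\<delta> > 0" for r \<delta>
    using diff_op_le_modulus[OF assms(1) that order_refl, of r 0] by linarith
  \<comment> \<open>The odd orders follow from the even ones, as \<open>gamma_star (2k - 1) = 2 * gamma_star (2k)\<close>.\<close>
  have step: "modulus_smoothness 2 f \<delta> \<le> 2 * modulus_smoothness 1 f \<delta>"
    "modulus_smoothness 4 f \<delta> \<le> 2 * modulus_smoothness 3 f \<delta>"
    "modulus_smoothness 6 f \<delta> \<le> 2 * modulus_smoothness 5 f \<delta>" if "\<delta> > 0" for \<delta>
    using modulus_Suc_le[OF assms(1) that, of 1] modulus_Suc_le[OF assms(1) that, of 3]
      modulus_Suc_le[OF assms(1) that, of 5] by (simp_all add: numeral_eq_Suc)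
  have r2: "?E \<le> 5 / 8 * ?a 2" "?E \<le> 17 / 32 * ?b 2"
    using best_approx_le_modulus_2[OF assms pos(1)] best_approx_le_modulus_2[OF assms pos(2)]
    unfolding \<kappa> by simp_all
  \<comment> \<open>Solving for \<open>E\<close> gives the smaller constants \<open>10/7\<close> and \<open>34/31\<close> in place of \<open>27/10\<close> and \<open>10/9\<close>.\<close>
  have r4: "?E \<le> 27 / 60 * ?a 4" "?E \<le> 10 / 54 * ?b 4"
    using best_approx_le_modulus_4[OF assms pos(1)] nonneg[OF pos(1), of 4]
      best_approx_le_modulus_4[OF assms pos(2)] nonneg[OF pos(2), of 4] unfolding \<kappa> by argo+
  have r6: "?E \<le> 3 / 40 * ?b 6"
    using best_approx_le_modulus_6[OF assms pos(2)] nonneg[OF pos(2), of 6] unfolding \<kappa> by argo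
  have "?E \<le> c_pi r * gamma_star r * ?a r" if "r \<in> {1..4}" for r
  proof -
    consider "r = 1" | "r = 2" | "r = 3" | "r = 4" using \<open>r \<in> {1..4}\<close> by force
    then show ?thesis
      using r2(1) r4(1) step[OF pos(1)] by cases (simp_all add: c_pi_def gamma_star_values gamma_star_values(1)[unfolded One_nat_def])
  qed
  moreover have "?E \<le> c_2pi r * gamma_star r * ?b r" if "r \<in> {1..6}" for r
  proof -
    consider "r = 1" | "r = 2" | "r = 3" | "r = 4" | "r = 5" | "r = 6" using \<open>r \<in> {1..6}\<close> by force
    then show ?thesis
      using r2(2) r4(2) r6 step[OF pos(2)] by cases (simp_all add: c_2pi_def gamma_star_values gamma_star_values(1)[unfolded One_nat_def])
  qed
  ultimately show ?thesis by blast
qed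

end
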